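(* Let $V$ be a vector space of dimension $\ell$ over a field $K$ of arbitrary characteristic, and let $\Delta=(\alpha_1,\dots,\alpha_n)$ be a sequence of nonzero elements of $V^*$ spanning $V^*$, with matroid $M(\Delta)$ on $\{1,\dots,n\}$ given by the rank function $r(S)=\dim\operatorname{span}\{\alpha_i:i\in S\}$. Let $C(\Delta)$ be the $K$-subalgebra of the field of rational functions on $V$ generated by $1/\alpha_1,\dots,1/\alpha_n$, graded by giving each $1/\alpha_i$ degree $1$. Then \[ \operatorname{Hilb}(C(\Delta),t)=\left(\frac{t}{1-t}\right)^{\ell}T(M(\Delta);1/t,0), \] where $T$ is the Tutte polynomial.
   Context: For a graded vector space $C=\bigoplus_{k\ge0}C_k$ with finite-dimensional pieces, $\operatorname{Hilb}(C,t)=\sum_{k\ge 0}\dim_K C_k\,t^k$. *)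

theory Defs
  imports
    "HOL-Library.Poly_Mapping"
    "HOL-Library.Function_Algebras"
    "HOL-Library.FuncSet"
    "HOL-Computational_Algebra.Polynomial_Factorial"
    "HOL-Computational_Algebra.Formal_Laurent_Series"
begin

definition dual_scale :: "'k::field \<Rightarrow> ('v \<Rightarrow> 'k) \<Rightarrow> 'v \<Rightarrow> 'k"
  where "dual_scale c \<phi> = (\<lambda>v. c * \<phi> v)"

global_interpretation dual: vector_space "dual_scale :: 'k::field \<Rightarrow> ('v \<Rightarrow> 'k) \<Rightarrow> 'v \<Rightarrow> 'k"
  by unfold_locales (auto simp: dual_scale_def fun_eq_iff algebra_simps)

definition dual_space :: "('k::field \<Rightarrow> 'v::ab_group_add \<Rightarrow> 'v) \<Rightarrow> ('v \<Rightarrow> 'k) set"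
  where "dual_space scale = {\<phi>. Vector_Spaces.linear scale (*) \<phi>}"

definition form_rank :: "(nat \<Rightarrow> 'v \<Rightarrow> 'k::field) \<Rightarrow> nat set \<Rightarrow> nat"
  where "form_rank \<alpha> S = dual.dim (\<alpha> ` S)"

text \<open>
  The Tutte polynomial of the matroid with ground set \<open>E\<close> and rank function \<open>r\<close>, evaluated at a
  point of an arbitrary commutative ring. The natural number subtractions do not truncate, since
  \<open>r S \<le> r E\<close> and \<open>r S \<le> card S\<close> in a matroid.
\<close>

definition tutte :: "'e set \<Rightarrow> ('e set \<Rightarrow> nat) \<Rightarrow> 'a::comm_ring_1 \<Rightarrow> 'a \<Rightarrow> 'a"
  where "tutte E r x y = (\<Sum>S\<in>Pow E. (x - 1) ^ (r E - r S) * (y - 1) ^ (card S - r S))"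

text \<open>
  Rational functions over \<open>'k\<close> in the variables \<open>x\<^sub>0, x\<^sub>1, \<dots>\<close>. A basis \<open>b\<^sub>0, \<dots>, b\<^bsub>\<ell>-1\<^esub>\<close> of \<open>V\<close>
  identifies the field of rational functions on \<open>V\<close>, i.e. the fraction field of the symmetric
  algebra of the dual space, with the subfield in the variables \<open>x\<^sub>0, \<dots>, x\<^bsub>\<ell>-1\<^esub>\<close>, where \<open>x\<^sub>j\<close> is
  the \<open>j\<close>-th dual basis vector. The unused variables do not affect subalgebras generated by
  elements of this subfield.
\<close>

type_synonym 'k mpoly = "(nat \<Rightarrow>\<^sub>0 nat) \<Rightarrow>\<^sub>0 'k"
type_synonym 'k ratfun = "'k mpoly fract"

definition ratfun_const :: "'k::field \<Rightarrow> 'k ratfun"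
  where "ratfun_const c = to_fract (Poly_Mapping.single 0 c)"

definition ratfun_scale :: "'k::field \<Rightarrow> 'k ratfun \<Rightarrow> 'k ratfun"
  where "ratfun_scale c f = ratfun_const c * f"

lemma ratfun_const_simps:
  "ratfun_const 0 = 0" "ratfun_const 1 = 1"
  "ratfun_const (c + d) = ratfun_const c + ratfun_const d"
  "ratfun_const (c * d) = ratfun_const c * ratfun_const d"
proof -
  show "ratfun_const 0 = 0" by (simp add: ratfun_const_def)
  show "ratfun_const 1 = 1" by (simp add: ratfun_const_def single_one)
  show "ratfun_const (c + d) = ratfun_const c + ratfun_const d"
    by (simp add: ratfun_const_def single_add to_fract_add)
  show "ratfun_const (c * d) = ratfun_const c * ratfun_const d"
    using mult_single[of "0 :: nat \<Rightarrow>\<^sub>0 nat" c 0 d]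
    by (simp add: ratfun_const_def to_fract_mult[symmetric])
qed

global_interpretation ratfun: vector_space "ratfun_scale :: 'k::field \<Rightarrow> 'k ratfun \<Rightarrow> 'k ratfun"
  by unfold_locales (auto simp: ratfun_scale_def ratfun_const_simps algebra_simps)

text \<open>The functional \<open>\<phi>\<close> as a linear form in the coordinates with respect to the basis \<open>bs\<close>.\<close>

definition linear_form :: "'v list \<Rightarrow> ('v \<Rightarrow> 'k::field) \<Rightarrow> 'k mpoly"
  where "linear_form bs \<phi> =
    (\<Sum>j<length bs. Poly_Mapping.single (Poly_Mapping.single j 1) (\<phi> (bs ! j)))"

inductive_set subalgebra_generated :: "'k::field ratfun set \<Rightarrow> 'k ratfun set"
  for G :: "'k ratfun set"
  where
    gen: "g \<in> G \<Longrightarrow> g \<in> subalgebra_generated G"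
  | const: "ratfun_const c \<in> subalgebra_generated G"
  | add: "f \<in> subalgebra_generated G \<Longrightarrow> g \<in> subalgebra_generated G \<Longrightarrow>
      f + g \<in> subalgebra_generated G"
  | mult: "f \<in> subalgebra_generated G \<Longrightarrow> g \<in> subalgebra_generated G \<Longrightarrow>
      f * g \<in> subalgebra_generated G"

definition monomials :: "'k::field ratfun set \<Rightarrow> nat \<Rightarrow> 'k ratfun set"
  where "monomials G k = {(\<Prod>j<k. s j) | s. s \<in> {..<k} \<rightarrow> G}"

definition reciprocals :: "'v list \<Rightarrow> nat \<Rightarrow> (nat \<Rightarrow> 'v \<Rightarrow> 'k::field) \<Rightarrow> 'k ratfun set"
  where "reciprocals bs n \<alpha> = (\<lambda>i. 1 / to_fract (linear_form bs (\<alpha> i))) ` {1..n}"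

definition C_algebra :: "'v list \<Rightarrow> nat \<Rightarrow> (nat \<Rightarrow> 'v \<Rightarrow> 'k::field) \<Rightarrow> 'k ratfun set"
  where "C_algebra bs n \<alpha> = subalgebra_generated (reciprocals bs n \<alpha>)"

text \<open>
  The degree \<open>k\<close> part of \<open>C(\<Delta>)\<close> when every generator is given degree 1. That this is a grading of
  the algebra is shown in \<open>C_part_reciprocal\<close>, \<open>C_part_mult\<close>, \<open>C_algebra_eq_sum\<close> and
  \<open>C_part_independent\<close> below.
\<close>

definition C_part :: "'v list \<Rightarrow> nat \<Rightarrow> (nat \<Rightarrow> 'v \<Rightarrow> 'k::field) \<Rightarrow> nat \<Rightarrow> 'k ratfun set"
  where "C_part bs n \<alpha> k =
    {f \<in> C_algebra bs n \<alpha>. f \<in> ratfun.span (monomials (reciprocals bs n \<alpha>) k)}"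

text \<open>To be applied to families of finite-dimensional subspaces only (see \<open>C_part_finite\<close>).\<close>

definition Hilb :: "(nat \<Rightarrow> 'k::field ratfun set) \<Rightarrow> rat fps"
  where "Hilb C = Abs_fps (\<lambda>k. of_nat (ratfun.dim (C k)))"


subsection \<open>The grading is well defined\<close>

lemma monomials_subset: "monomials G k \<subseteq> subalgebra_generated G"
proof -
  have "(\<Prod>j<k. s j) \<in> subalgebra_generated G" if "s \<in> {..<k} \<rightarrow> G" for s
    using that
  proof (induction k)
    case 0
    then show ?case
      using subalgebra_generated.const[of 1 G] by (simp add: ratfun_const_simps)
  next
    case (Suc k)
    then have "(\<Prod>j<k. s j) \<in> subalgebra_generated G" and "s k \<in> G" by (auto simp: Pi_iff)
    then show ?case
      by (simp add: subalgebra_generated.mult subalgebra_generated.gen)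
  qed
  then show ?thesis by (auto simp: monomials_def)
qed

lemma span_subset_subalgebra:
  assumes "A \<subseteq> subalgebra_generated G"
  shows "ratfun.span A \<subseteq> subalgebra_generated G"
proof
  fix f assume "f \<in> ratfun.span A"
  then show "f \<in> subalgebra_generated G"
  proof (induction rule: ratfun.span_induct_alt)
    case base
    then show ?case
      using subalgebra_generated.const[of 0 G] by (simp add: ratfun_const_simps)
  next
    case (step c x y)
    then show ?case
      using assms
      by (auto simp: ratfun_scale_def
          intro!: subalgebra_generated.add subalgebra_generated.mult subalgebra_generated.const)
  qed
qed

lemma C_part_eq: "C_part bs n \<alpha> k = ratfun.span (monomials (reciprocals bs n \<alpha>) k)"
  using span_subset_subalgebra[OF monomials_subset] by (auto simp: C_part_def C_algebra_def)

lemma C_part_finite: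
  "\<exists>B. finite B \<and> B \<subseteq> C_part bs n \<alpha> k \<and> C_part bs n \<alpha> k = ratfun.span B"
proof (intro exI conjI)
  let ?G = "reciprocals bs n \<alpha>"
  have "monomials ?G k \<subseteq> (\<lambda>s. \<Prod>j<k. s j) ` ({..<k} \<rightarrow>\<^sub>E ?G)"
  proof
    fix f assume "f \<in> monomials ?G k"
    then obtain s where s: "f = (\<Prod>j<k. s j)" "s \<in> {..<k} \<rightarrow> ?G" by (auto simp: monomials_def)
    have "f = (\<Prod>j<k. restrict s {..<k} j)" using s by simp
    moreover have "restrict s {..<k} \<in> {..<k} \<rightarrow>\<^sub>E ?G" using s by auto
    ultimately show "f \<in> (\<lambda>s. \<Prod>j<k. s j) ` ({..<k} \<rightarrow>\<^sub>E ?G)" by blast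
  qed
  moreover have "finite ({..<k} \<rightarrow>\<^sub>E ?G)"
    by (intro finite_PiE) (auto simp: reciprocals_def)
  ultimately show "finite (monomials ?G k)" by (meson finite_imageI finite_subset)
  show "monomials ?G k \<subseteq> C_part bs n \<alpha> k" by (simp add: C_part_eq ratfun.span_superset)
  show "C_part bs n \<alpha> k = ratfun.span (monomials ?G k)" by (rule C_part_eq)
qed

lemma C_part_reciprocal:
  assumes "i \<in> {1..n}"
  shows "1 / to_fract (linear_form bs (\<alpha> i)) \<in> C_part bs n \<alpha> 1"
proof -
  let ?g = "1 / to_fract (linear_form bs (\<alpha> i))"
  have "?g \<in> reciprocals bs n \<alpha>" using assms by (auto simp: reciprocals_def)
  then have "?g \<in> monomials (reciprocals bs n \<alpha>) 1"
    by (auto simp: monomials_def intro!: exI[of _ "\<lambda>_. ?g"])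
  then show ?thesis by (simp add: C_part_eq ratfun.span_base)
qed

lemma C_part_const: "ratfun_const c \<in> C_part bs n \<alpha> 0"
proof -
  have "1 \<in> monomials (reciprocals bs n \<alpha>) 0" by (auto simp: monomials_def)
  then have "ratfun_scale c 1 \<in> C_part bs n \<alpha> 0"
    by (simp add: C_part_eq ratfun.span_base ratfun.span_scale)
  then show ?thesis by (simp add: ratfun_scale_def)
qed

lemma monomials_mult:
  fixes f g :: "'a::field ratfun"
  assumes "f \<in> monomials G i" "g \<in> monomials G j"
  shows "f * g \<in> monomials G (i + j)"
proof -
  from assms obtain s t where s: "f = (\<Prod>a<i. s a)" "s \<in> {..<i} \<rightarrow> G"
    and t: "g = (\<Prod>a<j. t a)" "t \<in> {..<j} \<rightarrow> G"
    by (auto simp: monomials_def)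
  let ?u = "\<lambda>a. if a < i then s a else t (a - i)"
  have split: "(\<Prod>a<i + j. h a) = (\<Prod>a<i. h a) * (\<Prod>a<j. h (i + a))" for h :: "nat \<Rightarrow> 'a ratfun"
    by (induction j) (simp_all add: mult.assoc)
  have "(\<Prod>a<i + j. ?u a) = (\<Prod>a<i. s a) * (\<Prod>a<j. t a)"
    unfolding split by simp
  then have "f * g = (\<Prod>a<i + j. ?u a)" using s t by simp
  moreover have "?u \<in> {..<i + j} \<rightarrow> G" using s t by (auto simp: Pi_iff)
  ultimately show ?thesis unfolding monomials_def by blast
qed

lemma C_part_mult:
  fixes f g :: "'k::field ratfun"
  assumes "f \<in> C_part bs n \<alpha> i" "g \<in> C_part bs n \<alpha> j"
  shows "f * g \<in> C_part bs n \<alpha> (i + j)"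
proof -
  let ?M = "monomials (reciprocals bs n \<alpha>)"
  have *: "x * g \<in> ratfun.span (?M (i + j))" if "x \<in> ?M i" for x
    using assms(2) unfolding C_part_eq
  proof (induction rule: ratfun.span_induct_alt)
    case base
    then show ?case by (simp add: ratfun.span_zero)
  next
    case (step c y z)
    have "x * (ratfun_scale c y + z) = ratfun_scale c (x * y) + x * z"
      by (simp add: ratfun_scale_def algebra_simps)
    moreover have "x * y \<in> ratfun.span (?M (i + j))"
      using monomials_mult[OF that step(1)] by (rule ratfun.span_base)
    ultimately show ?case
      using step(2) by (simp only: ratfun.span_add ratfun.span_scale)
  qed
  show ?thesis
    using assms(1) unfolding C_part_eq
  proof (induction rule: ratfun.span_induct_alt)
    case base
    then show ?case by (simp add: ratfun.span_zero)
  next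
    case (step c y z)
    have "(ratfun_scale c y + z) * g = ratfun_scale c (y * g) + z * g"
      by (simp add: ratfun_scale_def algebra_simps)
    then show ?case
      using *[OF step(1)] step(2) by (simp only: ratfun.span_add ratfun.span_scale)
  qed
qed

lemma C_algebra_eq_sum:
  "C_algebra bs n \<alpha> = {(\<Sum>k\<le>N. c k) | N c. \<forall>k. c k \<in> C_part bs n \<alpha> k}" (is "_ = ?R")
proof
  let ?C = "C_part bs n \<alpha>"
  have zero: "0 \<in> ?C k" and plus: "f \<in> ?C k \<Longrightarrow> g \<in> ?C k \<Longrightarrow> f + g \<in> ?C k" for f g k
    by (simp_all add: C_part_eq ratfun.span_zero ratfun.span_add)
  have one: "f \<in> ?R" if "f \<in> ?C k" for f k
  proof -
    have "f = (\<Sum>i\<le>k. if i = k then f else 0)" by simp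
    moreover have "\<forall>i. (if i = k then f else 0) \<in> ?C i" using that zero by simp
    ultimately show ?thesis
      by (intro CollectI exI[of _ k] exI[of _ "\<lambda>i. if i = k then f else 0"]) simp
  qed
  have add: "f + g \<in> ?R" if fg: "f \<in> ?R" "g \<in> ?R" for f g
  proof -
    from fg obtain N c M d where f: "f = (\<Sum>k\<le>N. c k)" "\<And>k. c k \<in> ?C k"
      and g: "g = (\<Sum>k\<le>M. d k)" "\<And>k. d k \<in> ?C k" by auto
    let ?c = "\<lambda>k. if k \<le> N then c k else 0"
    let ?d = "\<lambda>k. if k \<le> M then d k else 0"
    have "f = (\<Sum>k\<le>max N M. ?c k)" "g = (\<Sum>k\<le>max N M. ?d k)"
      unfolding f g by (intro sum.mono_neutral_cong_left; auto)+
    then have "f + g = (\<Sum>k\<le>max N M. ?c k + ?d k)" by (simp add: sum.distrib)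
    moreover have "\<forall>k. ?c k + ?d k \<in> ?C k" using f g zero plus by simp
    ultimately show ?thesis
      by (intro CollectI exI[of _ "max N M"] exI[of _ "\<lambda>k. ?c k + ?d k"]) simp
  qed
  have zero_R: "0 \<in> ?R" using one[OF zero] .
  have sum: "(\<Sum>i\<in>I. h i) \<in> ?R" if "finite I" "\<And>i. i \<in> I \<Longrightarrow> h i \<in> ?R" for I :: "nat set" and h
    using that by (induction I rule: finite_induct) (simp_all add: zero_R add del: mem_Collect_eq)
  show "C_algebra bs n \<alpha> \<subseteq> ?R"
  proof
    fix f assume "f \<in> C_algebra bs n \<alpha>"
    then show "f \<in> ?R" unfolding C_algebra_def
    proof (induction rule: subalgebra_generated.induct)
      case (gen g)
      then obtain i where "i \<in> {1..n}" "g = 1 / to_fract (linear_form bs (\<alpha> i))"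
        by (auto simp: reciprocals_def)
      then show ?case using one[OF C_part_reciprocal[of i n bs \<alpha>]] by simp
    next
      case (const c)
      then show ?case using one[OF C_part_const] .
    next
      case (add f g)
      then show ?case using \<open>\<And>g f. f \<in> ?R \<Longrightarrow> g \<in> ?R \<Longrightarrow> f + g \<in> ?R\<close> by blast
    next
      case (mult f g)
      then obtain N c M d where f: "f = (\<Sum>k\<le>N. c k)" "\<And>k. c k \<in> ?C k"
        and g: "g = (\<Sum>k\<le>M. d k)" "\<And>k. d k \<in> ?C k" by auto
      have "f * g = (\<Sum>k\<le>N. \<Sum>m\<le>M. c k * d m)" by (simp add: f(1) g(1) sum_product)
      moreover have "(\<Sum>k\<le>N. \<Sum>m\<le>M. c k * d m) \<in> ?R"
        by (rule sum, simp, rule sum, simp, rule one[OF C_part_mult[OF f(2) g(2)]])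
      ultimately show ?case by (simp only:)
    qed
  qed
  show "?R \<subseteq> C_algebra bs n \<alpha>"
  proof
    fix f assume "f \<in> ?R"
    then obtain N c where f: "f = (\<Sum>k\<le>N. c k)" "\<And>k. c k \<in> ?C k" by auto
    have "(\<Sum>k\<le>N. c k) \<in> C_algebra bs n \<alpha>"
    proof (induction N)
      case 0
      then show ?case using f(2)[of 0] by (simp add: C_part_def)
    next
      case (Suc N)
      then show ?case
        using f(2)[of "Suc N"] by (simp add: C_part_def C_algebra_def subalgebra_generated.add)
    qed
    then show "f \<in> C_algebra bs n \<alpha>" by (simp add: f)
  qed
qed

definition total_degree :: "(nat \<Rightarrow>\<^sub>0 nat) \<Rightarrow> nat"
  where "total_degree m = (\<Sum>i\<in>Poly_Mapping.keys m. Poly_Mapping.lookup m i)"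

definition homogeneous :: "int \<Rightarrow> 'k::field mpoly \<Rightarrow> bool"
  where "homogeneous d p \<longleftrightarrow> (\<forall>m\<in>Poly_Mapping.keys p. int (total_degree m) = d)"

lemma total_degree_superset:
  assumes "finite A" "Poly_Mapping.keys m \<subseteq> A"
  shows "total_degree m = (\<Sum>i\<in>A. Poly_Mapping.lookup m i)"
  unfolding total_degree_def using assms
  by (intro sum.mono_neutral_left) (auto simp: in_keys_iff)

lemma total_degree_add: "total_degree (m + m') = total_degree m + total_degree m'"
proof -
  let ?A = "Poly_Mapping.keys m \<union> Poly_Mapping.keys m'"
  have "finite ?A" by simp
  moreover have "Poly_Mapping.keys (m + m') \<subseteq> ?A" by (rule keys_add)
  ultimately show ?thesis
    by (simp add: total_degree_superset[of ?A] lookup_add sum.distrib)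
qed

lemma homogeneous_0: "homogeneous d 0"
  by (simp add: homogeneous_def)

lemma homogeneous_1: "homogeneous 0 1"
  by (simp add: homogeneous_def total_degree_def)

lemma homogeneous_single: "int (total_degree m) = d \<Longrightarrow> homogeneous d (Poly_Mapping.single m c)"
  by (simp add: homogeneous_def)

lemma homogeneous_add: "homogeneous d p \<Longrightarrow> homogeneous d q \<Longrightarrow> homogeneous d (p + q)"
  unfolding homogeneous_def using keys_add[of p q] by blast

lemma homogeneous_mult:
  assumes "homogeneous d p" "homogeneous e q"
  shows "homogeneous (d + e) (p * q)"
  unfolding homogeneous_def
proof
  fix m assume "m \<in> Poly_Mapping.keys (p * q)"
  then obtain a b where "m = a + b" "a \<in> Poly_Mapping.keys p" "b \<in> Poly_Mapping.keys q"
    using keys_mult[of p q] by blast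
  then show "int (total_degree m) = d + e"
    using assms by (simp add: homogeneous_def total_degree_add)
qed

lemma homogeneous_sum:
  "finite A \<Longrightarrow> (\<And>i. i \<in> A \<Longrightarrow> homogeneous d (p i)) \<Longrightarrow> homogeneous d (\<Sum>i\<in>A. p i)"
  by (induction A rule: finite_induct) (auto intro: homogeneous_0 homogeneous_add)

lemma homogeneous_prod:
  "finite A \<Longrightarrow> (\<And>i. i \<in> A \<Longrightarrow> homogeneous d (p i)) \<Longrightarrow>
    homogeneous (int (card A) * d) (\<Prod>i\<in>A. p i)"
proof (induction A rule: finite_induct)
  case empty
  then show ?case by (simp add: homogeneous_1)
next
  case (insert x A)
  then have "homogeneous (d + int (card A) * d) (p x * (\<Prod>i\<in>A. p i))"
    by (intro homogeneous_mult) auto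
  then show ?case using insert by (simp add: algebra_simps)
qed

lemma homogeneous_sum_eq_0:
  assumes "finite A" "\<And>k. k \<in> A \<Longrightarrow> homogeneous (d k) (p k)" "inj_on d A"
    and "(\<Sum>k\<in>A. p k) = 0" and "k \<in> A"
  shows "p k = 0"
proof (rule poly_mapping_eqI)
  fix m
  show "Poly_Mapping.lookup (p k) m = Poly_Mapping.lookup 0 m"
  proof (rule ccontr)
    assume *: "Poly_Mapping.lookup (p k) m \<noteq> Poly_Mapping.lookup 0 m"
    then have m: "int (total_degree m) = d k"
      using assms(2,5) by (simp add: homogeneous_def in_keys_iff)
    have "Poly_Mapping.lookup (p j) m = 0" if "j \<in> A - {k}" for j
    proof (rule ccontr)
      assume "Poly_Mapping.lookup (p j) m \<noteq> 0"
      then have "int (total_degree m) = d j"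
        using assms(2) that by (simp add: homogeneous_def in_keys_iff)
      then show False using m assms(3,5) that by (auto dest: inj_onD)
    qed
    then have "(\<Sum>j\<in>A. Poly_Mapping.lookup (p j) m) = Poly_Mapping.lookup (p k) m"
      using assms(1,5) by (simp add: sum.remove)
    moreover have "(\<Sum>j\<in>A. Poly_Mapping.lookup (p j) m) = 0"
      using assms(4) by (metis lookup_sum lookup_zero)
    ultimately show False using * by simp
  qed
qed

lemma homogeneous_linear_form: "homogeneous 1 (linear_form bs \<phi>)"
  unfolding linear_form_def
  by (intro homogeneous_sum homogeneous_single) (simp_all add: total_degree_def)

lemma linear_form_nonzero:
  assumes "finite_dimensional_vector_space scale (set bs)"
    and "\<phi> \<in> dual_space scale" and "\<phi> \<noteq> 0"
  shows "linear_form bs \<phi> \<noteq> 0"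
proof
  assume 0: "linear_form bs \<phi> = 0"
  interpret V: finite_dimensional_vector_space scale "set bs" by fact
  have lin: "Vector_Spaces.linear scale (*) \<phi>" using assms(2) by (simp add: dual_space_def)
  then interpret L: Vector_Spaces.linear scale "(*)" \<phi> .
  have zero: "\<phi> b = 0" if "b \<in> set bs" for b
  proof -
    from that obtain j where j: "j < length bs" "b = bs ! j" by (auto simp: in_set_conv_nth)
    have inj: "Poly_Mapping.single i (Suc 0) = Poly_Mapping.single j (Suc 0) \<longleftrightarrow> i = j" for i
      by (metis keys_single nat.simps(3) singleton_inject)
    have "Poly_Mapping.lookup (linear_form bs \<phi>) (Poly_Mapping.single j 1) =
        (\<Sum>i<length bs. if i = j then \<phi> (bs ! i) else 0)"
      unfolding linear_form_def lookup_sum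
      by (intro sum.cong refl) (simp add: lookup_single when_def inj)
    then show ?thesis using 0 j by simp
  qed
  have "\<phi> v = 0" for v
  proof -
    have "v \<in> V.span (set bs)" by (simp add: V.span_Basis)
    then show ?thesis
      by (induction rule: V.span_induct_alt) (simp_all add: L.zero L.add L.scale zero)
  qed
  then show False using assms(3) by (simp add: fun_eq_iff)
qed

lemma to_fract_prod: "to_fract (\<Prod>i\<in>A. f i) = (\<Prod>i\<in>A. to_fract (f i))"
  by (induction A rule: infinite_finite_induct) simp_all

lemma to_fract_sum: "to_fract (\<Sum>i\<in>A. f i) = (\<Sum>i\<in>A. to_fract (f i))"
  by (induction A rule: infinite_finite_induct) simp_all

lemma C_part_independent:
  assumes "finite_dimensional_vector_space scale (set bs)"
    and "\<And>i. i \<in> {1..n} \<Longrightarrow> \<alpha> i \<in> dual_space scale"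
    and "\<And>i. i \<in> {1..n} \<Longrightarrow> \<alpha> i \<noteq> 0"
    and c: "\<And>k. k \<le> N \<Longrightarrow> c k \<in> C_part bs n \<alpha> k" and "(\<Sum>k\<le>N. c k) = 0" and "k \<le> N"
  shows "c k = 0"
proof -
  let ?L = "\<lambda>i. linear_form bs (\<alpha> i)"
  define P where "P = (\<Prod>i\<in>{1..n}. ?L i)"
  have L: "?L i \<noteq> 0" if "i \<in> {1..n}" for i
    using linear_form_nonzero assms(1-3) that by blast
  have P: "homogeneous (int n) P"
    using homogeneous_prod[of "{1..n}" 1 ?L] by (simp add: P_def homogeneous_linear_form)
  have P0: "P \<noteq> 0" using L by (simp add: P_def)
  have recip: "\<exists>q. homogeneous (int n - 1) q \<and> to_fract P * g = to_fract q"
    if g: "g \<in> reciprocals bs n \<alpha>" for g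
  proof -
    from g obtain i where i: "i \<in> {1..n}" "g = 1 / to_fract (?L i)"
      by (auto simp: reciprocals_def)
    let ?q = "\<Prod>j\<in>{1..n} - {i}. ?L j"
    have "P = ?L i * ?q" using i by (simp add: P_def prod.remove)
    then have "to_fract P * g = to_fract ?q" using L[OF i(1)] i(2) by simp
    moreover have "homogeneous (int n - 1) ?q"
      using homogeneous_prod[of "{1..n} - {i}" 1 ?L] i
      by (simp add: homogeneous_linear_form of_nat_diff)
    ultimately show ?thesis by blast
  qed
  have mono: "\<exists>q. homogeneous (int k * (int n - 1)) q \<and> to_fract P ^ k * f = to_fract q"
    if f: "f \<in> monomials (reciprocals bs n \<alpha>) k" for f k
  proof -
    from f obtain s where s: "f = (\<Prod>j<k. s j)" "s \<in> {..<k} \<rightarrow> reciprocals bs n \<alpha>"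
      by (auto simp: monomials_def)
    have "\<forall>j\<in>{..<k}. \<exists>q. homogeneous (int n - 1) q \<and> to_fract P * s j = to_fract q"
      using s(2) recip by (auto simp: Pi_iff)
    then obtain q where q: "\<And>j. j < k \<Longrightarrow> homogeneous (int n - 1) (q j)"
      "\<And>j. j < k \<Longrightarrow> to_fract P * s j = to_fract (q j)"
      by (auto simp: bchoice_iff)
    have "to_fract P ^ k * f = (\<Prod>j<k. to_fract P * s j)"
      by (simp add: s(1) prod.distrib)
    also have "\<dots> = to_fract (\<Prod>j<k. q j)"
      by (simp add: q(2) to_fract_prod)
    finally show ?thesis using homogeneous_prod[of "{..<k}" "int n - 1" q] q(1) by auto
  qed
  have part: "\<exists>q. homogeneous (int n * int N - int k) q \<and> to_fract P ^ N * f = to_fract q"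
    if f: "f \<in> C_part bs n \<alpha> k" and k: "k \<le> N" for f k
    using f unfolding C_part_eq
  proof (induction rule: ratfun.span_induct_alt)
    case base
    then show ?case by (intro exI[of _ 0]) (simp add: homogeneous_0)
  next
    case (step a x y)
    from mono[OF step(1)] obtain q where q: "homogeneous (int k * (int n - 1)) q"
      "to_fract P ^ k * x = to_fract q" by auto
    from step(2) obtain r where r: "homogeneous (int n * int N - int k) r"
      "to_fract P ^ N * y = to_fract r" by auto
    let ?q = "Poly_Mapping.single 0 a * (P ^ (N - k) * q)"
    have "homogeneous (int (N - k) * int n) (P ^ (N - k))"
      using homogeneous_prod[of "{..<N - k}" "int n" "\<lambda>_. P"] P by simp
    then have "homogeneous (0 + (int (N - k) * int n + int k * (int n - 1))) ?q"
      using q(1) by (intro homogeneous_mult homogeneous_single) (simp_all add: total_degree_def)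
    also have "0 + (int (N - k) * int n + int k * (int n - 1)) = int n * int N - int k"
      using k by (simp add: of_nat_diff algebra_simps)
    finally have "homogeneous (int n * int N - int k) (?q + r)"
      using r(1) by (intro homogeneous_add)
    moreover have "to_fract P ^ N * (ratfun_scale a x + y) = to_fract (?q + r)"
    proof -
      have "to_fract P ^ N = to_fract P ^ (N - k) * to_fract P ^ k"
        using k by (simp flip: power_add)
      then have "to_fract P ^ N * ratfun_scale a x
          = ratfun_const a * (to_fract P ^ (N - k) * (to_fract P ^ k * x))"
        by (simp add: ratfun_scale_def mult_ac)
      also have "\<dots> = to_fract ?q"
        using to_fract_prod[of "\<lambda>_. P" "{..<N - k}"] by (simp add: q(2) ratfun_const_def)
      finally show ?thesis by (simp add: distrib_left r(2))
    qed
    ultimately show ?case by blast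
  qed
  then have "\<forall>k\<in>{..N}. \<exists>q. homogeneous (int n * int N - int k) q \<and>
      to_fract P ^ N * c k = to_fract q"
    using c by auto
  then obtain q where q: "\<And>k. k \<le> N \<Longrightarrow> homogeneous (int n * int N - int k) (q k)"
    "\<And>k. k \<le> N \<Longrightarrow> to_fract P ^ N * c k = to_fract (q k)"
    by (auto simp: bchoice_iff)
  have "to_fract (\<Sum>k\<le>N. q k) = (\<Sum>k\<le>N. to_fract P ^ N * c k)"
    by (simp add: q(2) to_fract_sum)
  also have "\<dots> = 0" using assms(5) by (simp flip: sum_distrib_left)
  finally have "(\<Sum>k\<le>N. q k) = 0" by (simp only: to_fract_eq_0_iff)
  then have "q k = 0"
    using q(1) \<open>k \<le> N\<close>
    by (intro homogeneous_sum_eq_0[of "{..N}" "\<lambda>k. int n * int N - int k" q k])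
      (auto simp: inj_on_def)
  then show ?thesis using q(2)[OF \<open>k \<le> N\<close>] P0 by simp
qed

end

theory Submission
  imports Defs
begin

text \<open>
  Call \<open>S\<close> an nbc set if no \<open>\<alpha> i\<close> lies in the span of the \<open>\<alpha> j\<close> with \<open>j \<in> S\<close> and \<open>j > i\<close>. The
  monomials in the \<open>1 / \<alpha> i\<close> whose support is an nbc set form a basis of \<open>C(\<Delta>)\<close>. They span, since a
  relation \<open>\<alpha> i = \<Sum>\<^sub>j c j \<alpha> j\<close> moves exponents to smaller indices. They are independent by induction on
  \<open>n\<close>: the terms of a relation with the highest pole along \<open>\<alpha> n\<close>, restricted to the hyperplane
  \<open>\<alpha> n = 0\<close>, give a relation between nbc monomials of the contraction. So the Hilbert series is the sum
  of \<open>x ^ card S\<close> over the nbc sets, where \<open>x = t / (1 - t)\<close>, and by deletion and contraction this is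
  \<open>\<Sum>\<^sub>S (-1) ^ card S * (-x) ^ r S\<close>. As \<open>1 / t - 1 = 1 / x\<close>, this is \<open>x ^ \<ell>\<close> times the Tutte
  polynomial at \<open>(1 / t, 0)\<close>.
\<close>


subsection \<open>Substitution in polynomials\<close>

definition power_product :: "(nat \<Rightarrow> 'k::field mpoly) \<Rightarrow> (nat \<Rightarrow>\<^sub>0 nat) \<Rightarrow> 'k mpoly"
  where "power_product f m = (\<Prod>i\<in>Poly_Mapping.keys m. f i ^ Poly_Mapping.lookup m i)"

definition subst :: "(nat \<Rightarrow> 'k::field mpoly) \<Rightarrow> 'k mpoly \<Rightarrow> 'k mpoly"
  where "subst f p =
    (\<Sum>m\<in>Poly_Mapping.keys p. Poly_Mapping.single 0 (Poly_Mapping.lookup p m) * power_product f m)"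

lemma power_product_add: "power_product f (m + m') = power_product f m * power_product f m'"
proof -
  let ?A = "Poly_Mapping.keys m \<union> Poly_Mapping.keys m'"
  have *: "power_product f u = (\<Prod>i\<in>?A. f i ^ Poly_Mapping.lookup u i)"
    if "Poly_Mapping.keys u \<subseteq> ?A" for u
    unfolding power_product_def using that
    by (intro prod.mono_neutral_left) (auto simp: in_keys_iff)
  have "Poly_Mapping.keys (m + m') \<subseteq> ?A" by (rule keys_add)
  then show ?thesis
    by (simp add: * lookup_add power_add prod.distrib)
qed

lemma subst_0: "subst f 0 = 0"
  by (simp add: subst_def)

text \<open>Cancelled terms drop out of the support of the sum, which is harmless because a zero
  coefficient contributes zero.\<close>

lemma subst_add: "subst f (p + q) = subst f p + subst f q"
  unfolding subst_def
  by (rule setsum_keys_plus_distrib) (simp_all add: single_add algebra_simps)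

lemma subst_single: "subst f (Poly_Mapping.single m c) = Poly_Mapping.single 0 c * power_product f m"
  by (cases "c = 0") (simp_all add: subst_def)

lemma subst_sum: "subst f (\<Sum>i\<in>I. p i) = (\<Sum>i\<in>I. subst f (p i))"
  by (induction I rule: infinite_finite_induct) (simp_all add: subst_0 subst_add)

lemma poly_mapping_as_sum:
  "p = (\<Sum>m\<in>Poly_Mapping.keys p. Poly_Mapping.single m (Poly_Mapping.lookup p m))"
proof (rule poly_mapping_eqI)
  fix m
  show "Poly_Mapping.lookup p m =
      Poly_Mapping.lookup (\<Sum>m\<in>Poly_Mapping.keys p. Poly_Mapping.single m (Poly_Mapping.lookup p m)) m"
    by (simp add: lookup_sum lookup_single when_def in_keys_iff)
qed

lemma subst_mult: "subst f (p * q) = subst f p * subst f q"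
proof -
  let ?s = "\<lambda>p m. Poly_Mapping.single m (Poly_Mapping.lookup p m)"
  \<comment> \<open>Both sides are bilinear in \<open>p\<close> and \<open>q\<close>, so a product
    of two single terms suffices, where exponents add.\<close>
  have single_case: "subst f (Poly_Mapping.single m a * Poly_Mapping.single m' b) =
      subst f (Poly_Mapping.single m a) * subst f (Poly_Mapping.single m' b)" for m m' a b
  proof -
    have "Poly_Mapping.single 0 (a * b) = Poly_Mapping.single (0 :: nat \<Rightarrow>\<^sub>0 nat) a * Poly_Mapping.single 0 b"
      by (simp add: mult_single)
    then have "subst f (Poly_Mapping.single m a * Poly_Mapping.single m' b) =
        (Poly_Mapping.single 0 a * Poly_Mapping.single 0 b) * (power_product f m * power_product f m')"
      by (simp only: mult_single[of m a m' b] subst_single power_product_add)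
    then show ?thesis by (simp only: subst_single mult_ac)
  qed
  let ?P = "Poly_Mapping.keys p" and ?Q = "Poly_Mapping.keys q"
  have "p * q = (\<Sum>m\<in>?P. ?s p m) * (\<Sum>m\<in>?Q. ?s q m)"
    by (simp flip: poly_mapping_as_sum)
  also have "subst f \<dots> = (\<Sum>m\<in>?P. \<Sum>m'\<in>?Q. subst f (?s p m * ?s q m'))"
    by (simp only: sum_product subst_sum)
  also have "\<dots> = (\<Sum>m\<in>?P. \<Sum>m'\<in>?Q. subst f (?s p m) * subst f (?s q m'))"
    by (simp only: single_case)
  also have "\<dots> = subst f (\<Sum>m\<in>?P. ?s p m) * subst f (\<Sum>m\<in>?Q. ?s q m)"
    by (simp add: sum_product subst_sum)
  finally show ?thesis by (simp flip: poly_mapping_as_sum)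
qed

lemma subst_const: "subst f (Poly_Mapping.single 0 c) = Poly_Mapping.single 0 c"
  by (simp add: subst_single power_product_def)

section \<open>Linear polynomials and algebra homomorphisms\<close>

lemma homogeneous_1_keys:
  assumes "homogeneous 1 p" "m \<in> Poly_Mapping.keys p"
  obtains i where "m = Poly_Mapping.single i 1"
proof -
  have "int (total_degree m) = 1"
    using assms by (simp add: homogeneous_def)
  then have "(\<Sum>i\<in>Poly_Mapping.keys m. Poly_Mapping.lookup m i) = 1"
    by (simp add: total_degree_def flip: of_nat_sum)
  then obtain i where i: "i \<in> Poly_Mapping.keys m" "Poly_Mapping.lookup m i = 1"
    "\<And>j. j \<in> Poly_Mapping.keys m \<Longrightarrow> i \<noteq> j \<Longrightarrow> Poly_Mapping.lookup m j = 0"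
    unfolding sum_eq_1_iff[OF finite_keys] by blast
  have "m = Poly_Mapping.single i 1"
    by (rule poly_mapping_eqI) (use i in \<open>force simp: lookup_single when_def in_keys_iff\<close>)
  then show ?thesis by (rule that)
qed

lemma single_inject_left:
  "c \<noteq> 0 \<Longrightarrow> Poly_Mapping.single i c = Poly_Mapping.single j c \<longleftrightarrow> i = j"
  by (metis keys_single singleton_inject)

text \<open>Fixing the constants keeps the coefficients of a relation intact when it is restricted
  to a subspace; composition of such maps models repeated restriction to hyperplanes.\<close>

locale algebra_hom =
  fixes \<phi> :: "'k::field mpoly \<Rightarrow> 'k mpoly"
  assumes add: "\<phi> (p + q) = \<phi> p + \<phi> q"
    and mult: "\<phi> (p * q) = \<phi> p * \<phi> q"
    and const: "\<phi> (Poly_Mapping.single 0 c) = Poly_Mapping.single 0 c"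
begin

lemma zero: "\<phi> 0 = 0"
  using const[of 0] by simp

lemma one: "\<phi> 1 = 1"
  using const[of 1] by simp

lemma diff: "\<phi> (p - q) = \<phi> p - \<phi> q"
  using add[of "p - q" q] by simp

lemma power: "\<phi> (p ^ k) = \<phi> p ^ k"
  by (induction k) (simp_all add: one mult)

lemma sum: "\<phi> (\<Sum>i\<in>I. p i) = (\<Sum>i\<in>I. \<phi> (p i))"
  by (induction I rule: infinite_finite_induct) (simp_all add: zero add)

lemma prod: "\<phi> (\<Prod>i\<in>I. p i) = (\<Prod>i\<in>I. \<phi> (p i))"
  by (induction I rule: infinite_finite_induct) (simp_all add: one mult)

end

lemma algebra_hom_comp: "algebra_hom \<phi> \<Longrightarrow> algebra_hom \<theta> \<Longrightarrow> algebra_hom (\<lambda>p. \<theta> (\<phi> p))"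
  by (simp add: algebra_hom_def)

text \<open>Solving \<open>p = 0\<close> for a variable that occurs in \<open>p\<close>.\<close>

lemma specialization_exists:
  fixes p :: "'k::field mpoly"
  assumes p: "homogeneous 1 p" "p \<noteq> 0"
  obtains \<theta> where "algebra_hom \<theta>" "\<theta> p = 0"
    "\<And>q. homogeneous 1 q \<Longrightarrow> homogeneous 1 (\<theta> q)"
    "\<And>q. homogeneous 1 q \<Longrightarrow> \<theta> q = 0 \<Longrightarrow> \<exists>c. q = Poly_Mapping.single 0 c * p"
proof -
  let ?X = "\<lambda>i. Poly_Mapping.single (Poly_Mapping.single i 1) (1 :: 'k)"
  let ?co = "\<lambda>q i. Poly_Mapping.lookup q (Poly_Mapping.single i (1::nat))"
  from p(2) obtain m where m: "m \<in> Poly_Mapping.keys p"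
    by (metis in_keys_iff lookup_zero poly_mapping_eqI)
  with p(1) obtain j where "m = Poly_Mapping.single j 1" by (rule homogeneous_1_keys)
  with m have pj: "?co p j \<noteq> 0" by (simp add: in_keys_iff)
  \<comment> \<open>As \<open>p\<close> is linear, its multiple by the inverse of its
    \<open>j\<close>-th coefficient cancels the variable, so the value at \<open>j\<close> is what
    \<open>p = 0\<close> gives for that variable.\<close>
  define f where "f = (\<lambda>i. if i = j then ?X i - Poly_Mapping.single 0 (inverse (?co p j)) * p else ?X i)"
  have fj: "f j = ?X j - Poly_Mapping.single 0 (inverse (?co p j)) * p"
    by (simp add: f_def)
  have fi: "f i = ?X i" if "i \<noteq> j" for i
    using that by (simp add: f_def)
  define \<theta> where "\<theta> = subst f"
  \<comment> \<open>On linear polynomials \<open>\<theta>\<close> is the projection along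
    \<open>p\<close>, so its kernel there is the line spanned by \<open>p\<close>.\<close>
  have \<theta>: "\<theta> q = q - Poly_Mapping.single 0 (?co q j / ?co p j) * p" if q: "homogeneous 1 q" for q
  proof -
    have pp: "power_product f (Poly_Mapping.single i (Suc 0)) = f i" for i
      by (simp add: power_product_def)
    let ?K = "Poly_Mapping.keys q" and ?j = "Poly_Mapping.single j (Suc 0)"
    have *: "Poly_Mapping.single 0 (Poly_Mapping.lookup q m) * power_product f m =
        Poly_Mapping.single m (Poly_Mapping.lookup q m) -
        (if m = ?j then Poly_Mapping.single 0 (?co q j / ?co p j) * p else 0)" if m: "m \<in> ?K" for m
    proof -
      obtain i where i: "m = Poly_Mapping.single i 1"
        using q m by (rule homogeneous_1_keys)
      show ?thesis
      proof (cases "i = j")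
        case True
        have "Poly_Mapping.single 0 a * (?X j - Poly_Mapping.single 0 b * p) =
            Poly_Mapping.single ?j a - Poly_Mapping.single 0 (a * b) * p" for a b
          by (simp add: right_diff_distrib mult_single flip: mult.assoc)
        then show ?thesis using True by (simp add: i pp fj divide_inverse del: single_one)
      next
        case False
        then show ?thesis by (simp add: i pp fi single_inject_left mult_single)
      qed
    qed
    have "\<theta> q = (\<Sum>m\<in>?K. Poly_Mapping.single m (Poly_Mapping.lookup q m)) -
        (\<Sum>m\<in>?K. if m = ?j then Poly_Mapping.single 0 (?co q j / ?co p j) * p else 0)"
      unfolding \<theta>_def subst_def sum_subtractf[symmetric] using * by (rule sum.cong[OF refl])
    also have "(\<Sum>m\<in>?K. Poly_Mapping.single m (Poly_Mapping.lookup q m)) = q"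
      by (simp flip: poly_mapping_as_sum)
    also have "(\<Sum>m\<in>?K. if m = ?j then Poly_Mapping.single 0 (?co q j / ?co p j) * p else 0) =
        Poly_Mapping.single 0 (?co q j / ?co p j) * p"
      by (simp add: sum.delta' in_keys_iff)
    finally show ?thesis .
  qed
  show ?thesis
  proof (rule that)
    show "algebra_hom \<theta>"
      by unfold_locales (simp_all add: \<theta>_def subst_add subst_mult subst_const)
    show "\<theta> p = 0" using \<theta>[OF p(1)] pj by simp
    show "homogeneous 1 (\<theta> q)" if "homogeneous 1 q" for q
    proof -
      have "homogeneous (0 + 1) (Poly_Mapping.single 0 (- (?co q j / ?co p j)) * p)"
        using p(1) by (intro homogeneous_mult homogeneous_single) (simp_all add: total_degree_def)
      then have "homogeneous 1 (q + Poly_Mapping.single 0 (- (?co q j / ?co p j)) * p)"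
        using that by (intro homogeneous_add) simp_all
      then show ?thesis by (simp add: \<theta>[OF that] single_uminus)
    qed
    show "\<exists>c. q = Poly_Mapping.single 0 c * p" if "homogeneous 1 q" "\<theta> q = 0" for q
      using \<theta>[OF that(1)] that(2) by auto
  qed
qed


subsection \<open>Independence of the nbc monomials\<close>

lemma linear_form_add: "linear_form bs (\<phi> + \<psi>) = linear_form bs \<phi> + linear_form bs \<psi>"
  by (simp add: linear_form_def single_add sum.distrib)

lemma linear_form_scale:
  "linear_form bs (dual_scale c \<phi>) = Poly_Mapping.single 0 c * linear_form bs \<phi>"
  by (simp add: linear_form_def dual_scale_def sum_distrib_left mult_single)

lemma linear_form_0: "linear_form bs 0 = 0"
  by (simp add: linear_form_def)

lemma linear_form_diff: "linear_form bs (\<phi> - \<psi>) = linear_form bs \<phi> - linear_form bs \<psi>"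
  by (simp add: linear_form_def single_diff sum_subtractf)

lemma subspace_dual_space:
  assumes "vector_space scale"
  shows "dual.subspace (dual_space scale)"
proof -
  interpret V: vector_space scale by fact
  have *: "vector_space ((*) :: 'k \<Rightarrow> 'k \<Rightarrow> 'k::field)"
    by unfold_locales (simp_all add: algebra_simps)
  show ?thesis
    using assms * by (auto simp: dual.subspace_def dual_space_def Vector_Spaces.linear_iff dual_scale_def algebra_simps)
qed

text \<open>
  A broken circuit is a circuit without its smallest element, so (for nonzero vectors) these are the
  sets without a broken circuit, relative to the contraction of the span of \<open>Y\<close>.
\<close>

definition nbc :: "(nat \<Rightarrow> 'v \<Rightarrow> 'k::field) \<Rightarrow> nat \<Rightarrow> ('v \<Rightarrow> 'k) set \<Rightarrow> nat set \<Rightarrow> bool"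
  where "nbc \<alpha> n Y S \<longleftrightarrow> (\<forall>i\<in>{1..n}. \<alpha> i \<notin> dual.span (Y \<union> \<alpha> ` {j\<in>S. i < j}))"

text \<open>Deletion: no element of \<open>S\<close> exceeds \<open>Suc n\<close>, so the condition
  at this index involves \<open>Y\<close> alone.\<close>

lemma nbc_Suc:
  assumes "S \<subseteq> {1..n}"
  shows "nbc \<alpha> (Suc n) Y S \<longleftrightarrow> nbc \<alpha> n Y S \<and> \<alpha> (Suc n) \<notin> dual.span Y"
proof -
  have "{j\<in>S. Suc n < j} = {}" using assms by auto
  note * = this
  show ?thesis by (auto simp: nbc_def atLeastAtMostSuc_conv *)
qed

text \<open>Contraction: \<open>Suc n\<close> exceeds every other index, so its vector enters each
  of the other spans and may as well be put into \<open>Y\<close>.\<close>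

lemma nbc_Suc_insert:
  assumes "S \<subseteq> {1..n}"
  shows "nbc \<alpha> (Suc n) Y (insert (Suc n) S) \<longleftrightarrow>
    nbc \<alpha> n (insert (\<alpha> (Suc n)) Y) S \<and> \<alpha> (Suc n) \<notin> dual.span Y"
proof -
  have 1: "{j. (j = Suc n \<or> j \<in> S) \<and> Suc n < j} = {}" using assms by auto
  have "{j. (j = Suc n \<or> j \<in> S) \<and> i < j} = insert (Suc n) {j\<in>S. i < j}" if "i \<in> {1..n}" for i
    using that by auto
  then have 2: "Y \<union> \<alpha> ` {j. (j = Suc n \<or> j \<in> S) \<and> i < j} = insert (\<alpha> (Suc n)) Y \<union> \<alpha> ` {j\<in>S. i < j}"
    if "i \<in> {1..n}" for i
    using that by simp
  show ?thesis by (auto simp: nbc_def atLeastAtMostSuc_conv 1 2)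
qed

lemma nbc_not_in_span: "nbc \<alpha> n Y S \<Longrightarrow> i \<in> {1..n} \<Longrightarrow> \<alpha> i \<notin> dual.span Y"
  unfolding nbc_def using dual.span_mono[of Y "Y \<union> \<alpha> ` {j\<in>S. i < j}"] by blast

text \<open>
  The relation between the reciprocal monomials \<open>M\<close> is multiplied by the \<open>N\<close>-th power of the product of
  all forms. The homomorphism \<open>\<phi>\<close> is the restriction to the subspace where the forms in \<open>Y\<close> vanish.
\<close>

lemma nbc_monomials_independent:
  fixes \<alpha> :: "nat \<Rightarrow> 'v::ab_group_add \<Rightarrow> 'k::field" and F :: "nat multiset set"
  assumes "vector_space scale"
    and "algebra_hom \<phi>"
    and "\<And>p. homogeneous 1 p \<Longrightarrow> homogeneous 1 (\<phi> p)"
    and "\<And>u. u \<in> dual_space scale \<Longrightarrow> \<phi> (linear_form bs u) = 0 \<Longrightarrow> u \<in> dual.span Y"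
    and "\<And>i. i \<in> {1..n} \<Longrightarrow> \<alpha> i \<in> dual_space scale"
    and "finite F"
    and "\<And>M. M \<in> F \<Longrightarrow> nbc \<alpha> n Y (set_mset M \<inter> {1..n})"
    and "\<And>M M'. M \<in> F \<Longrightarrow> M' \<in> F \<Longrightarrow> (\<And>i. i \<in> {1..n} \<Longrightarrow> count M i = count M' i) \<Longrightarrow> M = M'"
    and "\<And>M i. M \<in> F \<Longrightarrow> count M i \<le> N"
    and "(\<Sum>M\<in>F. Poly_Mapping.single 0 (c M) *
      (\<Prod>i\<in>{1..n}. \<phi> (linear_form bs (\<alpha> i)) ^ (N - count M i))) = 0"
    and "M \<in> F"
  shows "c M = 0"
  using assms(2-)
\<comment> \<open>Deletion and contraction change \<open>\<phi>\<close>, \<open>Y\<close> and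
  \<open>F\<close>. The multisets are not truncated when an index is removed, hence the hypotheses
  look at them only on \<open>{1..n}\<close>.\<close>
proof (induction n arbitrary: \<phi> Y F M)
  case 0
  then have "F = {M}" by auto
  then have "Poly_Mapping.single (0 :: nat \<Rightarrow>\<^sub>0 nat) (c M) = 0" using "0.prems"(9) by simp
  then show ?case by (metis lookup_single_eq lookup_zero)
next
  case (Suc n)
  interpret \<phi>: algebra_hom \<phi> by (rule Suc.prems(1))
  note sub = subspace_dual_space[OF assms(1)]
  define L where "L i = \<phi> (linear_form bs (\<alpha> i))" for i
  define Q where "Q M = (\<Prod>i\<in>{1..n}. L i ^ (N - count M i))" for M
  let ?p = "L (Suc n)"
  let ?C = "\<lambda>M. Poly_Mapping.single (0 :: nat \<Rightarrow>\<^sub>0 nat) (c M)"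
  show ?case
  proof (rule ccontr)
    assume "c M \<noteq> 0"
    \<comment> \<open>Without the zero coefficients, the highest pole order \<open>t\<close> along
      the last form is attained by a term that really occurs.\<close>
    define G where "G = {M\<in>F. c M \<noteq> 0}"
    have fin: "finite G" and ne: "G \<noteq> {}" and GF: "G \<subseteq> F"
      using Suc.prems(5,10) \<open>c M \<noteq> 0\<close> by (auto simp: G_def)
    define t where "t = Max ((\<lambda>M. count M (Suc n)) ` G)"
    have le: "count M (Suc n) \<le> t" if "M \<in> G" for M
      using that fin by (simp add: t_def)
    have "t \<in> (\<lambda>M. count M (Suc n)) ` G"
      unfolding t_def using fin ne by (intro Max_in) auto
    then obtain M\<^sub>0 where M0: "M\<^sub>0 \<in> G" "count M\<^sub>0 (Suc n) = t" by auto
    have tN: "t \<le> N" using M0 GF Suc.prems(8) by fastforce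
    have nb0: "set_mset M \<inter> {1..Suc n} = set_mset M \<inter> {1..n}" if "count M (Suc n) = 0" for M
      using that by (auto simp: atLeastAtMostSuc_conv not_in_iff)
    have nb1: "set_mset M \<inter> {1..Suc n} = insert (Suc n) (set_mset M \<inter> {1..n})"
      if "count M (Suc n) \<noteq> 0" for M
      using that by (auto simp: atLeastAtMostSuc_conv not_in_iff)
    have y: "\<alpha> (Suc n) \<notin> dual.span Y"
      using Suc.prems(6)[of M\<^sub>0] M0 GF by (intro nbc_not_in_span) auto
    \<comment> \<open>The nbc condition keeps the last form out of the span of \<open>Y\<close>, so
      it does not vanish on the subspace.\<close>
    have p0: "?p \<noteq> 0"
      using Suc.prems(3)[of "\<alpha> (Suc n)"] Suc.prems(4)[of "Suc n"] y by (auto simp: L_def)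
    have "0 = (\<Sum>M\<in>F. ?C M * (\<Prod>i\<in>{1..Suc n}. L i ^ (N - count M i)))"
      using Suc.prems(9) by (simp add: L_def)
    also have "\<dots> = (\<Sum>M\<in>G. ?C M * (\<Prod>i\<in>{1..Suc n}. L i ^ (N - count M i)))"
      using Suc.prems(5) by (intro sum.mono_neutral_right) (auto simp: G_def)
    \<comment> \<open>Every pole order is at most \<open>t\<close>, so a common power of
      \<open>?p\<close> splits off; the terms of order \<open>t\<close> keep no further split-off
      factor \<open>?p\<close>.\<close>
    also have "\<dots> = (\<Sum>M\<in>G. ?p ^ (N - t) * (?C M * Q M * ?p ^ (t - count M (Suc n))))"
    proof (intro sum.cong refl)
      fix M assume "M \<in> G"
      then have "N - count M (Suc n) = (N - t) + (t - count M (Suc n))"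
        using le tN by force
      then show "?C M * (\<Prod>i\<in>{1..Suc n}. L i ^ (N - count M i)) =
          ?p ^ (N - t) * (?C M * Q M * ?p ^ (t - count M (Suc n)))"
        by (simp add: Q_def power_add mult_ac atLeastAtMostSuc_conv)
    qed
    finally have "?p ^ (N - t) * (\<Sum>M\<in>G. ?C M * Q M * ?p ^ (t - count M (Suc n))) = 0"
      by (simp add: sum_distrib_left)
    then have *: "(\<Sum>M\<in>G. ?C M * Q M * ?p ^ (t - count M (Suc n))) = 0"
      using p0 by simp
    show False
    proof (cases "t = 0")
      \<comment> \<open>Deletion: no term of \<open>G\<close> involves \<open>Suc n\<close>, so
        \<open>\<phi>\<close> and \<open>Y\<close> stay the same.\<close>
      case True
      then have z: "count M (Suc n) = 0" if "M \<in> G" for M using le that by force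
      have "c M\<^sub>0 = 0"
      proof (rule Suc.IH[of \<phi> Y G])
        show "nbc \<alpha> n Y (set_mset M \<inter> {1..n})" if "M \<in> G" for M
          using Suc.prems(6)[of M] that GF nb0[OF z[OF that]]
            nbc_Suc[of "set_mset M \<inter> {1..n}" n \<alpha> Y] by auto
        show "M = M'" if "M \<in> G" "M' \<in> G" "\<And>i. i \<in> {1..n} \<Longrightarrow> count M i = count M' i" for M M'
        proof (rule Suc.prems(7))
          show "count M i = count M' i" if "i \<in> {1..Suc n}" for i
            using that z \<open>M \<in> G\<close> \<open>M' \<in> G\<close> \<open>\<And>i. i \<in> {1..n} \<Longrightarrow> count M i = count M' i\<close>
            by (cases "i = Suc n") auto
        qed (use that GF in auto)
        show "(\<Sum>M\<in>G. ?C M * (\<Prod>i\<in>{1..n}. \<phi> (linear_form bs (\<alpha> i)) ^ (N - count M i))) = 0"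
          using * True by (simp add: Q_def L_def)
      qed (use Suc.prems(1-4) subsetD[OF GF] Suc.prems(8) M0 fin in simp_all)
      then show False using M0 by (simp add: G_def)
    next
      case False
      have "homogeneous 1 ?p"
        unfolding L_def by (intro Suc.prems(2) homogeneous_linear_form)
      then obtain \<theta> where \<theta>: "algebra_hom \<theta>" "\<theta> ?p = 0"
        "\<And>q. homogeneous 1 q \<Longrightarrow> homogeneous 1 (\<theta> q)"
        "\<And>q. homogeneous 1 q \<Longrightarrow> \<theta> q = 0 \<Longrightarrow> \<exists>c. q = Poly_Mapping.single 0 c * ?p"
        using p0 by (rule specialization_exists) blast
      interpret \<theta>: algebra_hom \<theta> by (rule \<theta>(1))
      \<comment> \<open>Contraction: since \<open>t > 0\<close>, these multisets all contain
        \<open>Suc n\<close>, and with the same multiplicity, so their counts on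
        \<open>{1..n}\<close> still tell them apart.\<close>
      define H where "H = {M\<in>G. count M (Suc n) = t}"
      have HF: "H \<subseteq> F" and HG: "H \<subseteq> G" and finH: "finite H"
        using GF fin by (auto simp: H_def)
      have "c M\<^sub>0 = 0"
      proof (rule Suc.IH[of "\<lambda>p. \<theta> (\<phi> p)" "insert (\<alpha> (Suc n)) Y" H])
        show "algebra_hom (\<lambda>p. \<theta> (\<phi> p))"
          using Suc.prems(1) \<theta>(1) by (rule algebra_hom_comp)
        show "u \<in> dual.span (insert (\<alpha> (Suc n)) Y)"
          if u: "u \<in> dual_space scale" "\<theta> (\<phi> (linear_form bs u)) = 0" for u
        proof -
          \<comment> \<open>If \<open>\<theta>\<close> kills the restricted form, that form is a
            multiple of \<open>?p\<close>; subtracting the same multiple of the last vector from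
            \<open>u\<close> gives a form killed by \<open>\<phi>\<close>.\<close>
          have "homogeneous 1 (\<phi> (linear_form bs u))"
            by (intro Suc.prems(2) homogeneous_linear_form)
          then obtain a where "\<phi> (linear_form bs u) = Poly_Mapping.single 0 a * ?p"
            using \<theta>(4) u(2) by blast
          then have "\<phi> (linear_form bs (u - dual_scale a (\<alpha> (Suc n)))) = 0"
            by (simp add: linear_form_diff linear_form_scale \<phi>.diff \<phi>.mult \<phi>.const L_def)
          moreover have "\<alpha> (Suc n) \<in> dual_space scale" by (rule Suc.prems(4)) simp
          then have "u - dual_scale a (\<alpha> (Suc n)) \<in> dual_space scale"
            by (rule dual.subspace_diff[OF sub u(1) dual.subspace_scale[OF sub]])
          ultimately have "u - dual_scale a (\<alpha> (Suc n)) \<in> dual.span Y"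
            using Suc.prems(3) by blast
          then show ?thesis by (auto simp: dual.span_breakdown_eq)
        qed
        show "nbc \<alpha> n (insert (\<alpha> (Suc n)) Y) (set_mset M \<inter> {1..n})" if "M \<in> H" for M
          using Suc.prems(6)[of M] that HF False nb1[of M]
            nbc_Suc_insert[of "set_mset M \<inter> {1..n}" n \<alpha> Y] by (auto simp: H_def)
        show "M = M'" if "M \<in> H" "M' \<in> H" "\<And>i. i \<in> {1..n} \<Longrightarrow> count M i = count M' i" for M M'
        proof (rule Suc.prems(7))
          show "count M i = count M' i" if "i \<in> {1..Suc n}" for i
            using that \<open>M \<in> H\<close> \<open>M' \<in> H\<close> \<open>\<And>i. i \<in> {1..n} \<Longrightarrow> count M i = count M' i\<close>
            by (cases "i = Suc n") (auto simp: H_def)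
        qed (use that HF in auto)
        have "0 = \<theta> (\<Sum>M\<in>G. ?C M * Q M * ?p ^ (t - count M (Suc n)))"
          by (simp add: * \<theta>.zero)
        \<comment> \<open>The power of 0 is 1 for pole order \<open>t\<close> and 0 below
          it.\<close>
        also have "\<dots> = (\<Sum>M\<in>G. ?C M * \<theta> (Q M) * 0 ^ (t - count M (Suc n)))"
          by (simp add: \<theta>.sum \<theta>.mult \<theta>.power \<theta>.const \<theta>(2))
        also have "\<dots> = (\<Sum>M\<in>H. ?C M * \<theta> (Q M))"
          using fin le by (intro sum.mono_neutral_cong_right) (force simp: H_def zero_power)+
        finally show "(\<Sum>M\<in>H. ?C M * (\<Prod>i\<in>{1..n}. \<theta> (\<phi> (linear_form bs (\<alpha> i))) ^ (N - count M i))) = 0"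
          by (simp add: Q_def L_def \<theta>.prod \<theta>.power)
      qed (use Suc.prems(2,4) \<theta>(3) M0 subsetD[OF HF] Suc.prems(8) finH in \<open>simp_all add: H_def\<close>)
      then show False using M0 by (simp add: G_def)
    qed
  qed
qed



subsection \<open>The nbc basis of the graded pieces\<close>

definition reciprocal_monomial :: "'v list \<Rightarrow> (nat \<Rightarrow> 'v \<Rightarrow> 'k::field) \<Rightarrow> nat multiset \<Rightarrow> 'k ratfun"
  where "reciprocal_monomial bs \<alpha> M = (\<Prod>i\<in>#M. 1 / to_fract (linear_form bs (\<alpha> i)))"

definition nbc_multisets :: "(nat \<Rightarrow> 'v \<Rightarrow> 'k::field) \<Rightarrow> nat \<Rightarrow> nat \<Rightarrow> nat multiset set"
  where "nbc_multisets \<alpha> n k = {M \<in> multisets_of_size {1..n} k. nbc \<alpha> n {} (set_mset M)}"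

lemma reciprocal_monomial_add_mset:
  "reciprocal_monomial bs \<alpha> (add_mset i M) =
    1 / to_fract (linear_form bs (\<alpha> i)) * reciprocal_monomial bs \<alpha> M"
  by (simp add: reciprocal_monomial_def)

lemma reciprocal_monomial_in_C_part:
  "set_mset M \<subseteq> {1..n} \<Longrightarrow> reciprocal_monomial bs \<alpha> M \<in> C_part bs n \<alpha> (size M)"
proof (induction M)
  case empty
  then show ?case
    using C_part_const[of 1 bs n \<alpha>] by (simp add: reciprocal_monomial_def ratfun_const_simps)
next
  case (add i M)
  then have "1 / to_fract (linear_form bs (\<alpha> i)) * reciprocal_monomial bs \<alpha> M \<in> C_part bs n \<alpha> (1 + size M)"
    by (intro C_part_mult C_part_reciprocal) auto
  then show ?case by (simp add: reciprocal_monomial_add_mset)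
qed

lemma monomials_reciprocals:
  "monomials (reciprocals bs n \<alpha>) k \<subseteq> reciprocal_monomial bs \<alpha> ` multisets_of_size {1..n} k"
proof -
  have "(\<Prod>j<k. s j) \<in> reciprocal_monomial bs \<alpha> ` multisets_of_size {1..n} k"
    if "s \<in> {..<k} \<rightarrow> reciprocals bs n \<alpha>" for s
    using that
  proof (induction k)
    case 0
    then show ?case by (simp add: reciprocal_monomial_def)
  next
    case (Suc k)
    then have "(\<Prod>j<k. s j) \<in> reciprocal_monomial bs \<alpha> ` multisets_of_size {1..n} k"
      and "s k \<in> reciprocals bs n \<alpha>" by (auto simp: Pi_iff)
    then obtain M i where M: "(\<Prod>j<k. s j) = reciprocal_monomial bs \<alpha> M" "M \<in> multisets_of_size {1..n} k"
      and i: "s k = 1 / to_fract (linear_form bs (\<alpha> i))" "i \<in> {1..n}"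
      by (auto simp: reciprocals_def)
    have "add_mset i M \<in> multisets_of_size {1..n} (Suc k)"
      using M(2) i(2) by (auto simp: multisets_of_size_def)
    moreover have "(\<Prod>j<Suc k. s j) = reciprocal_monomial bs \<alpha> (add_mset i M)"
      by (simp add: M(1) i(1) reciprocal_monomial_add_mset)
    ultimately show ?case by blast
  qed
  then show ?thesis by (auto simp: monomials_def)
qed

text \<open>
  If \<open>\<alpha> i\<close> is a combination of the \<open>\<alpha> j\<close> with \<open>j\<close> in \<open>M\<close> and \<open>j > i\<close>, then multiplying the monomial by
  \<open>\<alpha> i / \<alpha> i\<close> replaces such factors \<open>1 / \<alpha> j\<close> by \<open>1 / \<alpha> i\<close>, which decreases the sum of the indices.
\<close>

lemma reciprocal_monomial_in_nbc_span:
  fixes \<alpha> :: "nat \<Rightarrow> 'v \<Rightarrow> 'k::field"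
  assumes nz: "\<And>i. i \<in> {1..n} \<Longrightarrow> linear_form bs (\<alpha> i) \<noteq> 0"
    and "M \<in> multisets_of_size {1..n} k"
  shows "reciprocal_monomial bs \<alpha> M \<in> ratfun.span (reciprocal_monomial bs \<alpha> ` nbc_multisets \<alpha> n k)"
    (is "?f M \<in> ?W")
  using assms(2)
proof (induction "sum_mset M" arbitrary: M rule: less_induct)
  case less
  show ?case
  proof (cases "nbc \<alpha> n {} (set_mset M)")
    case True
    then show ?thesis using less.prems by (intro ratfun.span_base) (simp add: nbc_multisets_def)
  next
    case False
    then obtain i where i: "i \<in> {1..n}" "\<alpha> i \<in> dual.span (\<alpha> ` {j\<in>set_mset M. i < j})"
      by (auto simp: nbc_def)
    let ?L = "\<lambda>u. to_fract (linear_form bs u)"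
    \<comment> \<open>Stated for all \<open>w\<close> in the span so that span induction applies; at
      \<open>w = \<alpha> i\<close> the factor \<open>?L w\<close> cancels the denominator.\<close>
    have "?L w * (1 / ?L (\<alpha> i) * ?f M) \<in> ?W" if "w \<in> dual.span (\<alpha> ` {j\<in>set_mset M. i < j})" for w
      using that
    proof (induction rule: dual.span_induct_alt)
      case base
      show ?case by (simp only: linear_form_0 to_fract_0 mult_zero_left ratfun.span_zero)
    next
      case (step c u v)
      then obtain j where j: "u = \<alpha> j" "j \<in># M" "i < j" by auto
      obtain M' where M': "M = add_mset j M'" using j(2) by (metis multi_member_split)
      have jn: "j \<in> {1..n}" using less.prems j(2) by (auto simp: multisets_of_size_def)
      have "?f (add_mset i M') \<in> ?W"
        using less.prems i(1) j(3) by (intro less.hyps) (auto simp: M' multisets_of_size_def)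
      moreover have "?L u * (1 / ?L (\<alpha> i) * ?f M) = ?f (add_mset i M')"
        using nz[OF jn] by (simp add: j(1) M' reciprocal_monomial_add_mset)
      ultimately have "ratfun_scale c (?L u * (1 / ?L (\<alpha> i) * ?f M)) + ?L v * (1 / ?L (\<alpha> i) * ?f M) \<in> ?W"
        using step(2) by (simp only: ratfun.span_add ratfun.span_scale)
      also have "ratfun_scale c (?L u * (1 / ?L (\<alpha> i) * ?f M)) + ?L v * (1 / ?L (\<alpha> i) * ?f M) =
          ?L (dual_scale c u + v) * (1 / ?L (\<alpha> i) * ?f M)"
        by (simp add: linear_form_add linear_form_scale ratfun_scale_def ratfun_const_def add_divide_distrib distrib_right mult.assoc)
      finally show ?case .
    qed
    from this[OF i(2)] show ?thesis using nz[OF i(1)] by simp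
  qed
qed

lemma C_part_eq_nbc_span:
  assumes "\<And>i. i \<in> {1..n} \<Longrightarrow> linear_form bs (\<alpha> i) \<noteq> 0"
  shows "C_part bs n \<alpha> k = ratfun.span (reciprocal_monomial bs \<alpha> ` nbc_multisets \<alpha> n k)"
proof
  have "monomials (reciprocals bs n \<alpha>) k \<subseteq> ratfun.span (reciprocal_monomial bs \<alpha> ` nbc_multisets \<alpha> n k)"
    using monomials_reciprocals reciprocal_monomial_in_nbc_span[OF assms] by fast
  then show "C_part bs n \<alpha> k \<subseteq> ratfun.span (reciprocal_monomial bs \<alpha> ` nbc_multisets \<alpha> n k)"
    unfolding C_part_eq by (rule ratfun.span_minimal) simp
  have "reciprocal_monomial bs \<alpha> ` nbc_multisets \<alpha> n k \<subseteq> C_part bs n \<alpha> k"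
    using reciprocal_monomial_in_C_part[of _ n bs \<alpha>]
    by (auto simp: nbc_multisets_def multisets_of_size_def)
  then show "ratfun.span (reciprocal_monomial bs \<alpha> ` nbc_multisets \<alpha> n k) \<subseteq> C_part bs n \<alpha> k"
    unfolding C_part_eq by (rule ratfun.span_minimal) simp
qed

lemma finite_nbc_multisets: "finite (nbc_multisets \<alpha> n k)"
  by (simp add: nbc_multisets_def finite_multisets_of_size)

lemma reciprocal_monomials_linear_independent:
  fixes \<alpha> :: "nat \<Rightarrow> 'v::ab_group_add \<Rightarrow> 'k::field"
  assumes fd: "finite_dimensional_vector_space scale (set bs)"
    and \<alpha>: "\<And>i. i \<in> {1..n} \<Longrightarrow> \<alpha> i \<in> dual_space scale"
    and nz: "\<And>i. i \<in> {1..n} \<Longrightarrow> linear_form bs (\<alpha> i) \<noteq> 0"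
    and sum: "(\<Sum>M\<in>nbc_multisets \<alpha> n k. ratfun_scale (c M) (reciprocal_monomial bs \<alpha> M)) = 0"
    and M: "M \<in> nbc_multisets \<alpha> n k"
  shows "c M = 0"
proof -
  let ?F = "nbc_multisets \<alpha> n k"
  let ?L = "\<lambda>i. linear_form bs (\<alpha> i)"
  \<comment> \<open>The exponent \<open>k\<close> clears all denominators, as no multiplicity in a
    multiset of size \<open>k\<close> exceeds \<open>k\<close>.\<close>
  let ?P = "\<Prod>i\<in>{1..n}. to_fract (?L i) ^ k"
  have count: "count M i \<le> k" if "M \<in> ?F" for M i
    using that count_le_size[of M i] by (auto simp: nbc_multisets_def multisets_of_size_def)
  have sub: "set_mset M \<subseteq> {1..n}" if "M \<in> ?F" for M
    using that by (auto simp: nbc_multisets_def multisets_of_size_def)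
  have clear: "?P * reciprocal_monomial bs \<alpha> M = to_fract (\<Prod>i\<in>{1..n}. ?L i ^ (k - count M i))"
    if M: "M \<in> ?F" for M
  proof -
    have "reciprocal_monomial bs \<alpha> M = (\<Prod>i\<in>{1..n}. (1 / to_fract (?L i)) ^ count M i)"
      unfolding reciprocal_monomial_def image_prod_mset_multiplicity
      using sub[OF M] by (intro prod.mono_neutral_left) (auto simp: not_in_iff)
    then have "?P * reciprocal_monomial bs \<alpha> M =
        (\<Prod>i\<in>{1..n}. to_fract (?L i) ^ k * (1 / to_fract (?L i)) ^ count M i)"
      by (simp add: prod.distrib)
    also have "\<dots> = (\<Prod>i\<in>{1..n}. to_fract (?L i) ^ (k - count M i))"
    proof (intro prod.cong refl)
      fix i assume "i \<in> {1..n}"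
      then show "to_fract (?L i) ^ k * (1 / to_fract (?L i)) ^ count M i = to_fract (?L i) ^ (k - count M i)"
        using nz count[OF M, of i] by (simp add: power_diff power_one_over divide_inverse power_inverse)
    qed
    also have "\<dots> = to_fract (\<Prod>i\<in>{1..n}. ?L i ^ (k - count M i))"
    proof -
      have "to_fract (p ^ e) = to_fract p ^ e" for p :: "'k mpoly" and e
        by (induction e) simp_all
      then show ?thesis by (simp add: to_fract_prod)
    qed
    finally show ?thesis .
  qed
  have "0 = ?P * (\<Sum>M\<in>?F. ratfun_scale (c M) (reciprocal_monomial bs \<alpha> M))"
    by (simp add: sum)
  also have "\<dots> = (\<Sum>M\<in>?F. ratfun_const (c M) * (?P * reciprocal_monomial bs \<alpha> M))"
    by (simp add: sum_distrib_left ratfun_scale_def mult.left_commute)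
  also have "\<dots> = (\<Sum>M\<in>?F. ratfun_const (c M) * to_fract (\<Prod>i\<in>{1..n}. ?L i ^ (k - count M i)))"
    by (intro sum.cong refl) (simp only: clear)
  also have "\<dots> = to_fract (\<Sum>M\<in>?F. Poly_Mapping.single 0 (c M) * (\<Prod>i\<in>{1..n}. ?L i ^ (k - count M i)))"
    by (simp add: ratfun_const_def)
  finally have *: "(\<Sum>M\<in>?F. Poly_Mapping.single 0 (c M) * (\<Prod>i\<in>{1..n}. ?L i ^ (k - count M i))) = 0"
    by (rule to_fract_eq_0_iff[THEN iffD1, OF sym])
  interpret V: finite_dimensional_vector_space scale "set bs" by (rule fd)
  show ?thesis
  \<comment> \<open>The induction starts on all of the space: nothing is restricted and no form
    vanishes yet.\<close>
  proof (rule nbc_monomials_independent[where \<phi> = "\<lambda>p. p" and Y = "{}" and F = ?F and N = k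
        and scale = scale and bs = bs and \<alpha> = \<alpha> and n = n])
    show "vector_space scale" ..
    show "algebra_hom (\<lambda>p. p)" by unfold_locales auto
    show "u \<in> dual.span {}" if "u \<in> dual_space scale" "linear_form bs u = 0" for u
      using linear_form_nonzero[OF fd that(1)] that(2) by auto
    show "nbc \<alpha> n {} (set_mset M \<inter> {1..n})" if "M \<in> ?F" for M
      using that sub[OF that] by (simp add: nbc_multisets_def Int_absorb2)
    show "M = M'" if M: "M \<in> ?F" "M' \<in> ?F" "\<And>i. i \<in> {1..n} \<Longrightarrow> count M i = count M' i" for M M'
    proof (rule multiset_eqI)
      fix i
      show "count M i = count M' i"
      proof (cases "i \<in> {1..n}")
        case False
        then have "i \<notin># M" "i \<notin># M'" using sub[OF M(1)] sub[OF M(2)] by blast+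
        then show ?thesis by (simp add: not_in_iff)
      qed (rule M(3))
    qed
  qed (use \<alpha> count M * finite_nbc_multisets in auto)
qed

lemma dim_C_part:
  fixes \<alpha> :: "nat \<Rightarrow> 'v::ab_group_add \<Rightarrow> 'k::field"
  assumes fd: "finite_dimensional_vector_space scale (set bs)"
    and \<alpha>: "\<And>i. i \<in> {1..n} \<Longrightarrow> \<alpha> i \<in> dual_space scale"
    and nz: "\<And>i. i \<in> {1..n} \<Longrightarrow> linear_form bs (\<alpha> i) \<noteq> 0"
  shows "ratfun.dim (C_part bs n \<alpha> k) = card (nbc_multisets \<alpha> n k)"
proof -
  let ?F = "nbc_multisets \<alpha> n k" and ?f = "reciprocal_monomial bs \<alpha>"
  have indep: "c M = 0"
    if "(\<Sum>M\<in>?F. ratfun_scale (c M) (?f M)) = 0" "M \<in> ?F" for c M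
    using fd \<alpha> nz that by (rule reciprocal_monomials_linear_independent)
  have inj: "inj_on ?f ?F"
  proof (rule inj_onI, rule ccontr)
    fix M M' assume M: "M \<in> ?F" "M' \<in> ?F" "?f M = ?f M'" "M \<noteq> M'"
    \<comment> \<open>Independence as an indexed family also gives injectivity: two equal values
      would satisfy a relation with coefficients 1 and -1.\<close>
    define c where "c = (\<lambda>A. if A = M then 1 else if A = M' then - 1 else 0 :: 'k)"
    have "(\<Sum>A\<in>?F. ratfun_scale (c A) (?f A)) = (\<Sum>A\<in>{M, M'}. ratfun_scale (c A) (?f A))"
      using M by (intro sum.mono_neutral_right) (auto simp: finite_nbc_multisets c_def)
    also have "\<dots> = 0" using M by (simp add: c_def)
    finally have "c M = 0" using M(1) by (rule indep)
    then show False by (simp add: c_def)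
  qed
  have "ratfun.independent (?f ` ?F)"
  proof (rule ccontr)
    assume "\<not> ratfun.independent (?f ` ?F)"
    then obtain u v where u: "v \<in> ?f ` ?F" "u v \<noteq> 0" "(\<Sum>v\<in>?f ` ?F. ratfun_scale (u v) v) = 0"
      using ratfun.dependent_finite[of "?f ` ?F"] finite_nbc_multisets by blast
    then obtain M where M: "M \<in> ?F" "v = ?f M" by auto
    have "(\<Sum>M\<in>?F. ratfun_scale (u (?f M)) (?f M)) = 0"
      using u(3) by (simp add: sum.reindex[OF inj])
    then have "u (?f M) = 0" using M(1) by (rule indep[where c = "\<lambda>M. u (?f M)"])
    then show False using u(2) M(2) by simp
  qed
  then have "ratfun.dim (ratfun.span (?f ` ?F)) = card (?f ` ?F)"
    by (rule ratfun.dim_span_eq_card_independent)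
  moreover have "C_part bs n \<alpha> k = ratfun.span (?f ` ?F)"
    using nz by (rule C_part_eq_nbc_span)
  ultimately show ?thesis by (simp only: card_image[OF inj])
qed


subsection \<open>Counting nbc monomials\<close>

text \<open>The series \<open>g\<close> is t + t^2 + ... = t / (1 - t), one term for each positive
  multiplicity, and the multiplicities of different elements are independent choices.\<close>

lemma card_multisets_with_support:
  fixes g :: "'a::comm_ring_1 fps"
  assumes "finite S"
  defines "g \<equiv> Abs_fps (\<lambda>j. if j = 0 then 0 else 1)"
  shows "of_nat (card {M \<in> multisets_of_size S k. set_mset M = S}) = fps_nth (g ^ card S) k"
proof -
  have fin: "finite (multisets_of_size S k)" using assms(1) by (rule finite_multisets_of_size)
  have "g ^ card S = (\<Prod>i\<in>S. g)" by simp
  also have "fps_nth \<dots> k = (\<Sum>M\<in>multisets_of_size S k. \<Prod>i\<in>S. if count M i = 0 then 0 else 1)"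
    unfolding fps_prod_nth'[OF assms(1)] by (simp add: g_def)
  also have "\<dots> = (\<Sum>M\<in>multisets_of_size S k. if set_mset M = S then 1 else 0)"
  proof (intro sum.cong refl)
    fix M assume "M \<in> multisets_of_size S k"
    then have M: "set_mset M \<subseteq> S" by (simp add: multisets_of_size_def)
    show "(\<Prod>i\<in>S. if count M i = 0 then 0 else (1::'a)) = (if set_mset M = S then 1 else 0)"
    proof (cases "set_mset M = S")
      case True
      have "(\<Prod>i\<in>S. if count M i = 0 then 0 else (1::'a)) = (\<Prod>i\<in>S. 1)"
        using True by (intro prod.cong) (auto simp: count_eq_zero_iff)
      then show ?thesis using True by simp
    next
      case False
      then obtain i where "i \<in> S" "i \<notin># M" using M by auto
      then have "i \<in> S" "count M i = 0" by (simp_all add: not_in_iff)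
      then have "(\<Prod>i\<in>S. if count M i = 0 then 0 else (1::'a)) = 0"
        using assms(1) by (intro prod_zero bexI[of _ i]) simp_all
      then show ?thesis using False by simp
    qed
  qed
  also have "\<dots> = of_nat (card {M \<in> multisets_of_size S k. set_mset M = S})"
    using fin by (simp add: sum.If_cases Int_def)
  finally show ?thesis ..
qed

text \<open>Being nbc depends on the support alone, so the multisets are grouped by support.\<close>

lemma card_nbc_multisets:
  defines "g \<equiv> Abs_fps (\<lambda>j. if j = 0 then 0 else 1 :: 'a::comm_ring_1)"
  shows "Abs_fps (\<lambda>k. of_nat (card (nbc_multisets \<alpha> n k))) =
    (\<Sum>S | S \<subseteq> {1..n} \<and> nbc \<alpha> n {} S. g ^ card S)"
proof (rule fps_ext)
  fix k
  let ?I = "{S. S \<subseteq> {1..n} \<and> nbc \<alpha> n {} S}"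
  let ?A = "\<lambda>S. {M \<in> multisets_of_size S k. set_mset M = S}"
  have finS: "finite S" if "S \<in> ?I" for S using that by (auto intro: finite_subset)
  have "finite ?I" by (rule finite_subset[of _ "Pow {1..n}"]) auto
  have "nbc_multisets \<alpha> n k = (\<Union>S\<in>?I. ?A S)"
    by (auto simp: nbc_multisets_def multisets_of_size_def)
  also have "card \<dots> = (\<Sum>S\<in>?I. card (?A S))"
    using \<open>finite ?I\<close> finite_multisets_of_size[OF finS] by (intro card_UN_disjoint) auto
  finally have "of_nat (card (nbc_multisets \<alpha> n k)) = (\<Sum>S\<in>?I. of_nat (card (?A S)) :: 'a)"
    by simp
  also have "\<dots> = (\<Sum>S\<in>?I. fps_nth (g ^ card S) k)"
    unfolding g_def by (intro sum.cong refl card_multisets_with_support finS)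
  finally show "fps_nth (Abs_fps (\<lambda>k. of_nat (card (nbc_multisets \<alpha> n k)))) k =
      fps_nth (\<Sum>S\<in>?I. g ^ card S) k"
    by (simp add: fps_sum_nth)
qed

section \<open>Ranks and the Whitney expansion over nbc sets\<close>

text \<open>Finiteness matters: the ambient space of all functions may be infinite-dimensional, and
  \<open>dim\<close> is 0 by default on sets of infinite dimension.\<close>

lemma dual_dim_insert:
  assumes "finite Y"
  shows "dual.dim (insert y Y) = (if y \<in> dual.span Y then dual.dim Y else Suc (dual.dim Y))"
proof (cases "y \<in> dual.span Y")
  case True
  then have "dual.span (insert y Y) = dual.span Y" by (rule dual.span_redundant)
  then show ?thesis using True by (metis dual.span_eq_dim)
next
  case False
  obtain B where B: "B \<subseteq> Y" "dual.independent B" "Y \<subseteq> dual.span B" "card B = dual.dim Y"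
    by (rule dual.basis_exists)
  have sp: "dual.span B = dual.span Y"
    using dual.span_mono[OF B(1)] dual.span_minimal[OF B(3) dual.subspace_span] by (rule subset_antisym)
  have "finite B" using B(1) assms by (rule finite_subset)
  have y: "y \<notin> dual.span B" using False sp by simp
  then have "y \<notin> B" using dual.span_base by blast
  have "dual.dim (insert y Y) = card (insert y B)"
  proof (rule dual.dim_eq_card)
    show "dual.span (insert y B) = dual.span (insert y Y)"
      by (simp add: dual.span_insert sp)
    show "dual.independent (insert y B)" using y B(2) by (rule dual.independent_insertI)
  qed
  then show ?thesis using False B(4) \<open>finite B\<close> \<open>y \<notin> B\<close> by simp
qed

lemma dual_dim_mono:
  assumes "finite T" "S \<subseteq> T"
  shows "dual.dim S \<le> dual.dim T"
proof -
  obtain B where B: "B \<subseteq> T" "dual.independent B" "T \<subseteq> dual.span B" "card B = dual.dim T"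
    by (rule dual.basis_exists)
  show ?thesis
    using dual.dim_le_card[OF subset_trans[OF assms(2) B(3)] finite_subset[OF B(1) assms(1)]]
    by (simp add: B(4))
qed

lemma sum_Pow_insert:
  assumes "finite A" "a \<notin> A"
  shows "(\<Sum>S\<in>Pow (insert a A). g S) = (\<Sum>S\<in>Pow A. g S + g (insert a S))"
proof -
  have "inj_on (insert a) (Pow A)" using assms(2) by (auto simp: inj_on_def)
  then have "(\<Sum>S\<in>insert a ` Pow A. g S) = (\<Sum>S\<in>Pow A. g (insert a S))"
    by (simp add: sum.reindex)
  moreover have "Pow A \<inter> insert a ` Pow A = {}" using assms(2) by auto
  ultimately show ?thesis
    using assms(1) by (simp add: Pow_insert sum.union_disjoint sum.distrib)
qed

text \<open>Both sides obey the same deletion-contraction recursion in the largest index. For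
  invertible \<open>x\<close> the right side is the characteristic polynomial of the contraction at
  -1/x, times (-x) to its rank.\<close>

lemma whitney_nbc:
  fixes \<alpha> :: "nat \<Rightarrow> 'v \<Rightarrow> 'k::field" and x :: "'a::comm_ring_1"
  assumes "finite Y"
  shows "(\<Sum>S\<in>Pow {1..n}. if nbc \<alpha> n Y S then x ^ card S else 0) =
    (\<Sum>S\<in>Pow {1..n}. (- 1) ^ card S * (- x) ^ (dual.dim (Y \<union> \<alpha> ` S) - dual.dim Y))"
  using assms
proof (induction n arbitrary: Y)
  case 0
  then show ?case by (simp add: nbc_def)
next
  case (Suc n)
  let ?y = "\<alpha> (Suc n)"
  have E: "{1..Suc n} = insert (Suc n) {1..n}" by (simp add: atLeastAtMostSuc_conv)
  have fin: "finite S" and notin: "Suc n \<notin> S" if "S \<in> Pow {1..n}" for S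
    using that by (auto intro: finite_subset)
  show ?case
  proof (cases "?y \<in> dual.span Y")
    \<comment> \<open>A loop: no set is nbc, and on the right adding \<open>Suc n\<close> to
      \<open>S\<close> keeps the rank but flips the sign, so terms cancel in pairs.\<close>
    case True
    have dim: "dual.dim (insert ?y (Y \<union> \<alpha> ` S)) = dual.dim (Y \<union> \<alpha> ` S)" if "S \<in> Pow {1..n}" for S
    proof -
      have "?y \<in> dual.span (Y \<union> \<alpha> ` S)" using True dual.span_mono[of Y "Y \<union> \<alpha> ` S"] by blast
      then show ?thesis using dual_dim_insert[of "Y \<union> \<alpha> ` S" ?y] Suc.prems fin[OF that] by simp
    qed
    have "\<not> nbc \<alpha> (Suc n) Y S" for S using nbc_not_in_span True by fastforce
    moreover have "(\<Sum>S\<in>Pow {1..Suc n}. (- 1) ^ card S * (- x) ^ (dual.dim (Y \<union> \<alpha> ` S) - dual.dim Y)) = 0"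
      unfolding E by (subst sum_Pow_insert) (auto simp: dim fin notin intro!: sum.neutral)
    ultimately show ?thesis by simp
  next
    case False
    let ?Y = "insert ?y Y"
    have dY: "dual.dim ?Y = Suc (dual.dim Y)" using dual_dim_insert[OF Suc.prems] False by simp
    \<comment> \<open>The rank in the contraction is one less. The extra factor \<open>- x\<close>
      and the sign of the added element combine to the factor \<open>x\<close> of the
      recursion.\<close>
    have dim: "dual.dim (insert ?y (Y \<union> \<alpha> ` S)) - dual.dim Y = Suc (dual.dim (?Y \<union> \<alpha> ` S) - dual.dim ?Y)"
      if "S \<in> Pow {1..n}" for S
    proof -
      have "dual.dim ?Y \<le> dual.dim (?Y \<union> \<alpha> ` S)"
        using Suc.prems fin[OF that] by (intro dual_dim_mono) auto
      then show ?thesis by (simp add: dY)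
    qed
    have "(\<Sum>S\<in>Pow {1..Suc n}. if nbc \<alpha> (Suc n) Y S then x ^ card S else 0) =
        (\<Sum>S\<in>Pow {1..n}. (if nbc \<alpha> n Y S then x ^ card S else 0) + x * (if nbc \<alpha> n ?Y S then x ^ card S else 0))"
      unfolding E by (subst sum_Pow_insert)
        (use False in \<open>auto simp: nbc_Suc nbc_Suc_insert fin notin intro!: sum.cong\<close>)
    also have "\<dots> = (\<Sum>S\<in>Pow {1..n}. (- 1) ^ card S * (- x) ^ (dual.dim (Y \<union> \<alpha> ` S) - dual.dim Y)) +
        x * (\<Sum>S\<in>Pow {1..n}. (- 1) ^ card S * (- x) ^ (dual.dim (?Y \<union> \<alpha> ` S) - dual.dim ?Y))"
      using Suc.IH[of Y] Suc.IH[of ?Y] Suc.prems by (simp add: sum.distrib flip: sum_distrib_left)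
    also have "\<dots> = (\<Sum>S\<in>Pow {1..Suc n}. (- 1) ^ card S * (- x) ^ (dual.dim (Y \<union> \<alpha> ` S) - dual.dim Y))"
      unfolding E by (subst sum_Pow_insert)
        (auto simp: dim fin notin sum.distrib sum_distrib_left algebra_simps simp del: Un_insert_left)
    finally show ?thesis .
  qed
qed

section \<open>Dimension of the dual space\<close>

lemma dim_dual_space:
  fixes scale :: "'k::field \<Rightarrow> 'v::ab_group_add \<Rightarrow> 'v"
  assumes "finite_dimensional_vector_space scale B"
  shows "dual.dim (dual_space scale) = card B"
proof -
  interpret V: finite_dimensional_vector_space scale B by fact
  \<comment> \<open>The coordinate functions form the dual basis.\<close>
  define d where "d b v = V.representation B v b" for b v
  have B: "V.independent B" "\<And>v. v \<in> V.span B" "finite B"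
    by (simp_all add: V.independent_Basis V.span_Basis V.finite_Basis)
  have d_basis: "d b b' = (if b' = b then 1 else 0)" if "b' \<in> B" for b b'
    using that B by (simp add: d_def V.representation_basis)
  have field: "vector_space ((*) :: 'k \<Rightarrow> 'k \<Rightarrow> 'k)"
    by unfold_locales (simp_all add: algebra_simps)
  have d_dual: "d b \<in> dual_space scale" for b
    using B field V.vector_space_axioms
    by (simp add: d_def dual_space_def Vector_Spaces.linear_iff V.representation_add V.representation_scale)
  have eval: "(\<Sum>v\<in>I. h v) x = (\<Sum>v\<in>I. h v x)" for h :: "'i \<Rightarrow> 'v \<Rightarrow> 'k" and I x
    by (induction I rule: infinite_finite_induct) auto
  have inj: "inj_on d B"
    by (rule inj_onI) (metis d_basis zero_neq_one)
  have "dual.independent (d ` B)"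
  proof (rule ccontr)
    assume "\<not> dual.independent (d ` B)"
    then obtain u w where u: "w \<in> d ` B" "u w \<noteq> 0" "(\<Sum>w\<in>d ` B. dual_scale (u w) w) = 0"
      using dual.dependent_finite[of "d ` B"] B(3) by blast
    then obtain b where b: "b \<in> B" "w = d b" by auto
    \<comment> \<open>Evaluation at the basis vector \<open>b\<close> isolates the coefficient of
      \<open>d b\<close>.\<close>
    have "(\<Sum>b'\<in>B. dual_scale (u (d b')) (d b')) b = 0"
      using u(3) by (simp add: sum.reindex[OF inj])
    then have "(\<Sum>b'\<in>B. u (d b') * (if b = b' then 1 else 0)) = 0"
      using b(1) by (simp add: eval dual_scale_def d_basis)
    then have "u (d b) = 0" using b(1) B(3) by (simp add: mult_delta_right)
    then show False using u(2) b(2) by simp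
  qed
  moreover have "dual_space scale \<subseteq> dual.span (d ` B)"
  proof
    fix u assume u: "u \<in> dual_space scale"
    then interpret u: Vector_Spaces.linear scale "(*)" u by (simp add: dual_space_def)
    have "u v = (\<Sum>b\<in>B. dual_scale (u b) (d b)) v" for v
    proof -
      have "u v = u (\<Sum>b\<in>B. scale (V.representation B v b) b)"
        using V.sum_representation_eq[of B v B] B by simp
      then show ?thesis by (simp add: u.sum u.scale eval dual_scale_def d_def mult.commute)
    qed
    then have "u = (\<Sum>b\<in>B. dual_scale (u b) (d b))" by blast
    then show "u \<in> dual.span (d ` B)"
      by (metis (no_types, lifting) dual.span_base dual.span_scale dual.span_sum imageI)
  qed
  ultimately show ?thesis
    using dual.dim_unique[of "d ` B" "dual_space scale" "card B"] d_dual card_image[OF inj] by blast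
qed

section \<open>From the Whitney expansion to the Tutte polynomial\<close>

text \<open>With z = t / (1 - t), the Tutte variables at (1/t, 0) shifted by 1 are 1/z and -1. This
  matches the two expansions term by term.\<close>

lemma nonzero_Tutte_term:
  fixes z :: "'a::field"
  assumes "z \<noteq> 0" "r \<le> l" "r \<le> c"
  shows "z ^ l * ((1 / z) ^ (l - r) * (- 1) ^ (c - r)) = (- 1) ^ c * (- z) ^ r"
proof -
  have "z ^ l = z ^ r * z ^ (l - r)" using assms(2) by (simp flip: power_add)
  moreover have "(- 1 :: 'a) ^ c = (- 1) ^ (c - r) * (- 1) ^ r" using assms(3) by (simp flip: power_add)
  moreover have "(- 1) ^ r * (- z) ^ r = z ^ r" by (simp flip: power_mult_distrib)
  ultimately show ?thesis using assms(1) by (simp add: power_one_over mult_ac)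
qed

theorem theorem4p3:
  fixes scale :: "'k::field \<Rightarrow> 'v::ab_group_add \<Rightarrow> 'v"
    and bs :: "'v list"
    and \<alpha> :: "nat \<Rightarrow> 'v \<Rightarrow> 'k"
    and l n :: nat
  assumes "finite_dimensional_vector_space scale (set bs)" and "distinct bs"
    and "vector_space.dim scale UNIV = l"
    and "\<And>i. i \<in> {1..n} \<Longrightarrow> \<alpha> i \<in> dual_space scale"
    and "\<And>i. i \<in> {1..n} \<Longrightarrow> \<alpha> i \<noteq> 0"
    and "dual.span (\<alpha> ` {1..n}) = dual_space scale"
  shows "fps_to_fls (Hilb (C_part bs n \<alpha>)) =
    (fls_X / (1 - fls_X)) ^ l * tutte {1..n} (form_rank \<alpha>) (1 / fls_X) 0"
proof -
  interpret V: finite_dimensional_vector_space scale "set bs" by fact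
  \<comment> \<open>The Hilbert series is a power series but 1/t is not, so the comparison takes
    place among Laurent series, where \<open>g\<close> becomes \<open>z\<close>.\<close>
  define g :: "rat fps" where "g = Abs_fps (\<lambda>j. if j = 0 then 0 else 1)"
  define z :: "rat fls" where "z = fls_X / (1 - fls_X)"
  have X1: "(1 - fls_X :: rat fls) \<noteq> 0"
    by (metis eq_iff_diff_eq_0 fls_X_nonzero fps_X_neq_one fps_X_to_fls fps_to_fls_eq_1_iff)
  then have z0: "z \<noteq> 0" by (simp add: z_def)
  have "g * (1 - fps_X) = fps_X"
    by (rule fps_ext) (auto simp: g_def right_diff_distrib fps_X_nth)
  then have "fps_to_fls g * (1 - fls_X) = fls_X"
    by (metis fls_times_fps_to_fls fps_X_to_fls fps_one_to_fls fps_to_fls_minus)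
  then have g: "fps_to_fls g = z" using X1 by (simp add: z_def nonzero_eq_divide_eq)
  have inv: "1 / fls_X - 1 = 1 / z"
    using X1 by (simp add: z_def diff_divide_distrib)
  have nz: "linear_form bs (\<alpha> i) \<noteq> 0" if "i \<in> {1..n}" for i
    using linear_form_nonzero assms(1,4,5) that by blast
  \<comment> \<open>The forms span the dual space, so the matroid has full rank.\<close>
  have rank_E: "form_rank \<alpha> {1..n} = l"
  proof -
    have "form_rank \<alpha> {1..n} = dual.dim (dual_space scale)"
      by (metis assms(6) dual.dim_span form_rank_def)
    also have "\<dots> = l" using dim_dual_space[OF assms(1)] assms(3) V.dim_UNIV by simp
    finally show ?thesis .
  qed
  let ?r = "form_rank \<alpha>"
  have fls_sum: "fps_to_fls (\<Sum>S\<in>I. h S) = (\<Sum>S\<in>I. fps_to_fls (h S))"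
    for h :: "nat set \<Rightarrow> rat fps" and I
    by (induction I rule: infinite_finite_induct) simp_all
  have "Hilb (C_part bs n \<alpha>) = (\<Sum>S | S \<subseteq> {1..n} \<and> nbc \<alpha> n {} S. g ^ card S)"
    unfolding Hilb_def g_def card_nbc_multisets[symmetric]
    using dim_C_part[OF assms(1,4) nz] by simp
  then have "fps_to_fls (Hilb (C_part bs n \<alpha>)) = (\<Sum>S | S \<subseteq> {1..n} \<and> nbc \<alpha> n {} S. z ^ card S)"
    by (simp add: fls_sum fps_to_fls_power g)
  also have "\<dots> = (\<Sum>S\<in>Pow {1..n}. if nbc \<alpha> n {} S then z ^ card S else 0)"
    by (simp add: sum.inter_filter[symmetric] Pow_def)
  \<comment> \<open>For empty \<open>Y\<close> the subtracted dimension is 0, which leaves the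
    matroid rank itself.\<close>
  also have "\<dots> = (\<Sum>S\<in>Pow {1..n}. (- 1) ^ card S * (- z) ^ ?r S)"
    using whitney_nbc[where Y = "{}" and \<alpha> = \<alpha> and x = z and n = n]
      dual.dim_le_card'[of "{} :: ('v \<Rightarrow> 'k) set"] by (simp add: form_rank_def)
  also have "\<dots> = (\<Sum>S\<in>Pow {1..n}. z ^ l * ((1 / fls_X - 1) ^ (l - ?r S) * (0 - 1) ^ (card S - ?r S)))"
  proof (intro sum.cong refl)
    fix S assume S: "S \<in> Pow {1..n}"
    then have "finite S" by (auto intro: finite_subset)
    \<comment> \<open>These two bounds ensure that the natural number subtractions in the exponents
      do not truncate.\<close>
    have "?r S \<le> l"
      unfolding rank_E[symmetric] form_rank_def using S by (intro dual_dim_mono) auto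
    moreover have "?r S \<le> card S"
      using dual.dim_le_card'[of "\<alpha> ` S"] card_image_le[OF \<open>finite S\<close>, of \<alpha>] \<open>finite S\<close>
      by (simp add: form_rank_def)
    ultimately show "(- 1) ^ card S * (- z) ^ ?r S =
        z ^ l * ((1 / fls_X - 1) ^ (l - ?r S) * (0 - 1) ^ (card S - ?r S))"
      by (simp only: inv diff_0 nonzero_Tutte_term[OF z0])
  qed
  also have "\<dots> = z ^ l * tutte {1..n} ?r (1 / fls_X) 0"
    by (simp only: tutte_def rank_E sum_distrib_left)
  finally show ?thesis by (simp add: z_def)
qed

end
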